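(* Let $\mathbb F$ be a field, let $\mathcal A$ be a central, perfect $\mathbb F$-algebra, let $\mathcal B$ be a unital commutative associative $\mathbb F$-algebra, and let $\mathcal C$ be a unital subalgebra of $\mathcal B$ such that $\mathcal B$ is a free $\mathcal C$-module with a $\mathcal C$-basis containing the identity element $1$ of $\mathcal B$. Suppose further that $\mathcal L$ is a $\mathcal C$-form of $\mathcal A\otimes_{\mathbb F}\mathcal B$, i.e. a subalgebra of the $\mathcal C$-algebra $\mathcal A\otimes_{\mathbb F}\mathcal B$ such that $\mathcal L\otimes_{\mathcal C}\mathcal B\cong\mathcal A\otimes_{\mathbb F}\mathcal B$ (as $\mathcal B$-algebras). Then $\operatorname{Cent}_{\mathbb F}(\mathcal L)=\mathcal C\,\mathrm{id}$.
   Context: Algebras are not assumed associative, Lie, or unital unless stated. For an $\mathbb F$-algebra $\mathcal A$, $\operatorname{Cent}_{\mathbb F}(\mathcal A)=\{\chi\in\operatorname{End}_{\mathbb F}(\mathcal A)\mid\chi(ab)=a\chi(b)=\chi(a)b\ \forall a,b\in\mathcal A\}$. $\mathcal A$ is central if $\operatorname{Cent}_{\mathbb F}(\mathcal A)=\mathbb F\,\mathrm{id}$, and perfect if $\mathcal A$ is spanned by all products $ab$. The product on $\mathcal A\otimes_{\mathbb F}\mathcal B$ is $(a_1\otimes b_1)(a_2\otimes b_2)=a_1a_2\otimes b_1b_2$; it is a $\mathcal B$-algebra, hence a $\mathcal C$-algebra, via multiplication on the second factor. $\mathcal C\,\mathrm{id}$ is the set of maps $x\mapsto cx$, $c\in\mathcal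 C$, on $\mathcal L$. *)

theory Defs
  imports "HOL-Algebra.Module" "HOL-Algebra.Subrings" "HOL-Algebra.Generated_Groups"
    "HOL-Algebra.Free_Abelian_Groups"
begin

section \<open>Nonassociative algebras\<close>

text \<open>
  Algebras are represented by the record type \<^type>\<open>module\<close>. An algebra that is not assumed
  unital uses every component of that record except \<open>one\<close>, which is then an arbitrary value
  about which nothing is assumed.
\<close>

locale nonassoc_algebra = module R A for R (structure) and A (structure) +
  assumes prod_closed: "\<lbrakk>x \<in> carrier A; y \<in> carrier A\<rbrakk> \<Longrightarrow> x \<otimes>\<^bsub>A\<^esub> y \<in> carrier A"
    and prod_add_left: "\<lbrakk>x \<in> carrier A; y \<in> carrier A; z \<in> carrier A\<rbrakk>
      \<Longrightarrow> (x \<oplus>\<^bsub>A\<^esub> y) \<otimes>\<^bsub>A\<^esub> z = x \<otimes>\<^bsub>A\<^esub> z \<oplus>\<^bsub>A\<^esub> y \<otimes>\<^bsub>A\<^esub> z"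
    and prod_add_right: "\<lbrakk>x \<in> carrier A; y \<in> carrier A; z \<in> carrier A\<rbrakk>
      \<Longrightarrow> x \<otimes>\<^bsub>A\<^esub> (y \<oplus>\<^bsub>A\<^esub> z) = x \<otimes>\<^bsub>A\<^esub> y \<oplus>\<^bsub>A\<^esub> x \<otimes>\<^bsub>A\<^esub> z"
    and prod_smult_left: "\<lbrakk>r \<in> carrier R; x \<in> carrier A; y \<in> carrier A\<rbrakk>
      \<Longrightarrow> (r \<odot>\<^bsub>A\<^esub> x) \<otimes>\<^bsub>A\<^esub> y = r \<odot>\<^bsub>A\<^esub> (x \<otimes>\<^bsub>A\<^esub> y)"
    and prod_smult_right: "\<lbrakk>r \<in> carrier R; x \<in> carrier A; y \<in> carrier A\<rbrakk>
      \<Longrightarrow> x \<otimes>\<^bsub>A\<^esub> (r \<odot>\<^bsub>A\<^esub> y) = r \<odot>\<^bsub>A\<^esub> (x \<otimes>\<^bsub>A\<^esub> y)"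

definition alg_iso ::
  "('r, 'k) ring_scheme \<Rightarrow> ('r, 'a, 'm) module_scheme \<Rightarrow> ('r, 'b, 'n) module_scheme \<Rightarrow> ('a \<Rightarrow> 'b) set"
  where "alg_iso R A A' = {\<phi>. bij_betw \<phi> (carrier A) (carrier A') \<and>
    (\<forall>x\<in>carrier A. \<forall>y\<in>carrier A. \<phi> (x \<oplus>\<^bsub>A\<^esub> y) = \<phi> x \<oplus>\<^bsub>A'\<^esub> \<phi> y) \<and>
    (\<forall>x\<in>carrier A. \<forall>y\<in>carrier A. \<phi> (x \<otimes>\<^bsub>A\<^esub> y) = \<phi> x \<otimes>\<^bsub>A'\<^esub> \<phi> y) \<and>
    (\<forall>r\<in>carrier R. \<forall>x\<in>carrier A. \<phi> (r \<odot>\<^bsub>A\<^esub> x) = r \<odot>\<^bsub>A'\<^esub> \<phi> x)}"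

definition nonunital_subalgebra ::
  "'a set \<Rightarrow> ('r, 'k) ring_scheme \<Rightarrow> ('r, 'a, 'm) module_scheme \<Rightarrow> bool"
  where "nonunital_subalgebra L R A \<longleftrightarrow>
    submodule L R A \<and> (\<forall>x\<in>L. \<forall>y\<in>L. x \<otimes>\<^bsub>A\<^esub> y \<in> L)"

definition unital_subalgebra ::
  "'b set \<Rightarrow> ('r, 'k) ring_scheme \<Rightarrow> ('r, 'b, 'm) module_scheme \<Rightarrow> bool"
  where "unital_subalgebra C R B \<longleftrightarrow> subring C B \<and> submodule C R B"

definition lin_span ::
  "('r, 'k) ring_scheme \<Rightarrow> ('r, 'a, 'm) module_scheme \<Rightarrow> 'a set \<Rightarrow> 'a set"
  where "lin_span R M X =
    {(\<Oplus>\<^bsub>M\<^esub>x\<in>S. f x \<odot>\<^bsub>M\<^esub> x) | S f. finite S \<and> S \<subseteq> X \<and> f \<in> S \<rightarrow> carrier R}"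

definition lin_indep ::
  "('r, 'k) ring_scheme \<Rightarrow> ('r, 'a, 'm) module_scheme \<Rightarrow> 'a set \<Rightarrow> bool"
  where "lin_indep R M X \<longleftrightarrow> (\<forall>S f. finite S \<and> S \<subseteq> X \<and> f \<in> S \<rightarrow> carrier R \<and>
    (\<Oplus>\<^bsub>M\<^esub>x\<in>S. f x \<odot>\<^bsub>M\<^esub> x) = \<zero>\<^bsub>M\<^esub> \<longrightarrow> (\<forall>x\<in>S. f x = \<zero>\<^bsub>R\<^esub>))"

definition module_basis ::
  "('r, 'k) ring_scheme \<Rightarrow> ('r, 'a, 'm) module_scheme \<Rightarrow> 'a set \<Rightarrow> bool"
  where "module_basis R M X \<longleftrightarrow> X \<subseteq> carrier M \<and> lin_indep R M X \<and> lin_span R M X = carrier M"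


section \<open>Centroid\<close>

text \<open>
  Endomorphisms are extensional functions on the carrier, so that they are
  equal if and only if they agree on the carrier.
\<close>

definition module_End ::
  "('r, 'k) ring_scheme \<Rightarrow> ('r, 'a, 'm) module_scheme \<Rightarrow> ('a \<Rightarrow> 'a) set"
  where "module_End R M = {\<chi> \<in> carrier M \<rightarrow>\<^sub>E carrier M.
    (\<forall>x\<in>carrier M. \<forall>y\<in>carrier M. \<chi> (x \<oplus>\<^bsub>M\<^esub> y) = \<chi> x \<oplus>\<^bsub>M\<^esub> \<chi> y) \<and>
    (\<forall>r\<in>carrier R. \<forall>x\<in>carrier M. \<chi> (r \<odot>\<^bsub>M\<^esub> x) = r \<odot>\<^bsub>M\<^esub> \<chi> x)}"

definition Cent ::
  "('r, 'k) ring_scheme \<Rightarrow> ('r, 'a, 'm) module_scheme \<Rightarrow> ('a \<Rightarrow> 'a) set"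
  where "Cent R A = {\<chi> \<in> module_End R A. \<forall>a\<in>carrier A. \<forall>b\<in>carrier A.
    \<chi> (a \<otimes>\<^bsub>A\<^esub> b) = a \<otimes>\<^bsub>A\<^esub> \<chi> b \<and> \<chi> (a \<otimes>\<^bsub>A\<^esub> b) = \<chi> a \<otimes>\<^bsub>A\<^esub> b}"

definition scalar_maps ::
  "('r, 'k) ring_scheme \<Rightarrow> ('r, 'a, 'm) module_scheme \<Rightarrow> ('a \<Rightarrow> 'a) set"
  where "scalar_maps R M = {(\<lambda>x\<in>carrier M. r \<odot>\<^bsub>M\<^esub> x) | r. r \<in> carrier R}"

definition central_algebra ::
  "('r, 'k) ring_scheme \<Rightarrow> ('r, 'a, 'm) module_scheme \<Rightarrow> bool"
  where "central_algebra R A \<longleftrightarrow> Cent R A = scalar_maps R A"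

definition perfect_algebra ::
  "('r, 'k) ring_scheme \<Rightarrow> ('r, 'a, 'm) module_scheme \<Rightarrow> bool"
  where "perfect_algebra R A \<longleftrightarrow>
    lin_span R A {a \<otimes>\<^bsub>A\<^esub> b | a b. a \<in> carrier A \<and> b \<in> carrier A} = carrier A"


section \<open>Tensor products\<close>

text \<open>
  The tensor product of two \<open>R\<close>-modules is the free abelian group on pairs modulo
  the usual relations. Its elements are cosets of formal integer combinations of pairs.
\<close>

definition tensor_relators ::
  "('r, 'k) ring_scheme \<Rightarrow> ('r, 'a, 'm) module_scheme \<Rightarrow> ('r, 'b, 'n) module_scheme
    \<Rightarrow> ('a \<times> 'b \<Rightarrow>\<^sub>0 int) set"
  where "tensor_relators R M N =
    {frag_of (a \<oplus>\<^bsub>M\<^esub> a', b) - frag_of (a, b) - frag_of (a', b) | a a' b.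
        a \<in> carrier M \<and> a' \<in> carrier M \<and> b \<in> carrier N} \<union>
    {frag_of (a, b \<oplus>\<^bsub>N\<^esub> b') - frag_of (a, b) - frag_of (a, b') | a b b'.
        a \<in> carrier M \<and> b \<in> carrier N \<and> b' \<in> carrier N} \<union>
    {frag_of (r \<odot>\<^bsub>M\<^esub> a, b) - frag_of (a, r \<odot>\<^bsub>N\<^esub> b) | r a b.
        r \<in> carrier R \<and> a \<in> carrier M \<and> b \<in> carrier N}"

abbreviation pair_sums ::
  "('r, 'a, 'm) module_scheme \<Rightarrow> ('r, 'b, 'n) module_scheme \<Rightarrow> ('a \<times> 'b \<Rightarrow>\<^sub>0 int) monoid"
  where "pair_sums M N \<equiv> free_Abelian_group (carrier M \<times> carrier N)"

definition tensor_rel ::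
  "('r, 'k) ring_scheme \<Rightarrow> ('r, 'a, 'm) module_scheme \<Rightarrow> ('r, 'b, 'n) module_scheme
    \<Rightarrow> ('a \<times> 'b \<Rightarrow>\<^sub>0 int) set"
  where "tensor_rel R M N = generate (pair_sums M N) (tensor_relators R M N)"

definition tensor_class ::
  "('r, 'k) ring_scheme \<Rightarrow> ('r, 'a, 'm) module_scheme \<Rightarrow> ('r, 'b, 'n) module_scheme
    \<Rightarrow> ('a \<times> 'b \<Rightarrow>\<^sub>0 int) \<Rightarrow> ('a \<times> 'b \<Rightarrow>\<^sub>0 int) set"
  where "tensor_class R M N x = tensor_rel R M N #>\<^bsub>pair_sums M N\<^esub> x"

definition pure_tensor ::
  "('r, 'k) ring_scheme \<Rightarrow> ('r, 'a, 'm) module_scheme \<Rightarrow> ('r, 'b, 'n) module_scheme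
    \<Rightarrow> 'a \<Rightarrow> 'b \<Rightarrow> ('a \<times> 'b \<Rightarrow>\<^sub>0 int) set"
  where "pure_tensor R M N a b = tensor_class R M N (frag_of (a, b))"

text \<open>
  The maps on cosets below are unions over all representatives of the cosets involved.
  Since the underlying maps on formal sums respect the relations, every
  representative contributes the same coset; see \<open>tensor_mult_class\<close> and
  \<open>tensor_action_class\<close>.
\<close>

definition tensor_mult ::
  "('r, 'k) ring_scheme \<Rightarrow> ('r, 'a, 'm) module_scheme \<Rightarrow> ('r, 'b, 'n) module_scheme
    \<Rightarrow> ('a \<times> 'b \<Rightarrow>\<^sub>0 int) set \<Rightarrow> ('a \<times> 'b \<Rightarrow>\<^sub>0 int) set \<Rightarrow> ('a \<times> 'b \<Rightarrow>\<^sub>0 int) set"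
  where "tensor_mult R M N X Y = (\<Union>x\<in>X. \<Union>y\<in>Y. tensor_class R M N
    (frag_extend (\<lambda>(a, b). frag_extend (\<lambda>(a', b'). frag_of (a \<otimes>\<^bsub>M\<^esub> a', b \<otimes>\<^bsub>N\<^esub> b')) y) x))"

definition tensor_action ::
  "('r, 'k) ring_scheme \<Rightarrow> ('r, 'a, 'm) module_scheme \<Rightarrow> ('r, 'b, 'n) module_scheme
    \<Rightarrow> ('a \<times> 'b \<Rightarrow> 'a \<times> 'b) \<Rightarrow> ('a \<times> 'b \<Rightarrow>\<^sub>0 int) set \<Rightarrow> ('a \<times> 'b \<Rightarrow>\<^sub>0 int) set"
  where "tensor_action R M N f X =
    (\<Union>x\<in>X. tensor_class R M N (frag_extend (\<lambda>p. frag_of (f p)) x))"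

text \<open>\<open>M \<otimes>\<^sub>R N\<close> as an \<open>R\<close>-algebra:\<close>

definition tensor_algebra ::
  "('r, 'k) ring_scheme \<Rightarrow> ('r, 'a, 'm) module_scheme \<Rightarrow> ('r, 'b, 'n) module_scheme
    \<Rightarrow> ('r, ('a \<times> 'b \<Rightarrow>\<^sub>0 int) set) module"
  where "tensor_algebra R M N =
    \<lparr>carrier = carrier (pair_sums M N Mod tensor_rel R M N),
     monoid.mult = tensor_mult R M N,
     one = pure_tensor R M N \<one>\<^bsub>M\<^esub> \<one>\<^bsub>N\<^esub>,
     ring.zero = one (pair_sums M N Mod tensor_rel R M N),
     ring.add = monoid.mult (pair_sums M N Mod tensor_rel R M N),
     smult = (\<lambda>r. tensor_action R M N (\<lambda>(a, b). (r \<odot>\<^bsub>M\<^esub> a, b)))\<rparr>"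

definition with_smult :: "('b, 'x) ring_scheme \<Rightarrow> ('s \<Rightarrow> 'b \<Rightarrow> 'b) \<Rightarrow> ('s, 'b) module"
  where "with_smult T act =
    \<lparr>carrier = carrier T, monoid.mult = monoid.mult T, one = one T,
     ring.zero = ring.zero T, ring.add = ring.add T,
     smult = act\<rparr>"

text \<open>
  \<open>M \<otimes>\<^sub>R B\<close> as a \<open>B\<close>-algebra, by multiplication on the second factor. Restricting the scalars
  to a subring \<open>C\<close> of \<open>B\<close> leaves this record unchanged: the \<open>C\<close>-algebra \<open>M \<otimes>\<^sub>R B\<close> is
  \<open>base_change R M B\<close>, considered over the ring \<open>B\<lparr>carrier := C\<rparr>\<close>.
\<close>

definition base_change ::
  "('r, 'k) ring_scheme \<Rightarrow> ('r, 'a, 'm) module_scheme \<Rightarrow> ('r, 'b, 'n) module_scheme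
    \<Rightarrow> ('b, ('a \<times> 'b \<Rightarrow>\<^sub>0 int) set) module"
  where "base_change R M B = with_smult (tensor_algebra R M B)
    (\<lambda>s. tensor_action R M B (\<lambda>(a, b). (a, s \<otimes>\<^bsub>B\<^esub> b)))"

text \<open>A ring as a module over itself, and hence over each of its subrings:\<close>

definition self_module :: "('b, 'x) ring_scheme \<Rightarrow> ('b, 'b) module"
  where "self_module B = with_smult B (monoid.mult B)"

text \<open>\<open>L\<close> is a \<open>C\<close>-form of \<open>A \<otimes>\<^sub>F B\<close>; the isomorphism is one of \<open>B\<close>-algebras
  \<open>L \<otimes>\<^sub>C B \<cong> A \<otimes>\<^sub>F B\<close> and is not required to be the canonical map.\<close>

definition is_form ::
  "('f, 'k) ring_scheme \<Rightarrow> ('f, 'a, 'm) module_scheme \<Rightarrow> ('f, 'b, 'n) module_scheme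
    \<Rightarrow> 'b set \<Rightarrow> ('a \<times> 'b \<Rightarrow>\<^sub>0 int) set set \<Rightarrow> bool"
  where "is_form F A B C L \<longleftrightarrow>
    nonunital_subalgebra L (B\<lparr>carrier := C\<rparr>) (base_change F A B) \<and>
    alg_iso B
      (base_change (B\<lparr>carrier := C\<rparr>) ((base_change F A B)\<lparr>carrier := L\<rparr>) (self_module B))
      (base_change F A B) \<noteq> {}"


section \<open>The tensor product operations are well defined\<close>

lemma algebra_imp_nonassoc_algebra:
  assumes "algebra R B" shows "nonassoc_algebra R B"
proof -
  interpret algebra R B by fact
  have c: "x \<otimes>\<^bsub>B\<^esub> y = y \<otimes>\<^bsub>B\<^esub> x" if "x \<in> carrier B" "y \<in> carrier B" for x y
    using cring.cring_simprules(14)[OF M_cring] that by simp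
  have s: "x \<otimes>\<^bsub>B\<^esub> (r \<odot>\<^bsub>B\<^esub> y) = r \<odot>\<^bsub>B\<^esub> (x \<otimes>\<^bsub>B\<^esub> y)"
    if "r \<in> carrier R" "x \<in> carrier B" "y \<in> carrier B" for r x y
    using c[of x "r \<odot>\<^bsub>B\<^esub> y"] c[of x y] that by (simp add: smult_assoc2)
  note ring = cring.axioms(1)[OF M_cring]
  have "(x \<oplus>\<^bsub>B\<^esub> y) \<otimes>\<^bsub>B\<^esub> z = x \<otimes>\<^bsub>B\<^esub> z \<oplus>\<^bsub>B\<^esub> y \<otimes>\<^bsub>B\<^esub> z"
    "z \<otimes>\<^bsub>B\<^esub> (x \<oplus>\<^bsub>B\<^esub> y) = z \<otimes>\<^bsub>B\<^esub> x \<oplus>\<^bsub>B\<^esub> z \<otimes>\<^bsub>B\<^esub> y"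
    if "x \<in> carrier B" "y \<in> carrier B" "z \<in> carrier B" for x y z
    using that by (fact ring.ring_simprules[OF ring])+
  moreover have "x \<otimes>\<^bsub>B\<^esub> y \<in> carrier B" if "x \<in> carrier B" "y \<in> carrier B" for x y
    using that by (fact ring.ring_simprules[OF ring])
  ultimately show ?thesis
    by (intro nonassoc_algebra.intro nonassoc_algebra_axioms.intro module)
      (simp_all only: s smult_assoc2)
qed

lemma tensor_relators_subset:
  assumes "module R M" "module R N"
  shows "tensor_relators R M N \<subseteq> carrier (pair_sums M N)"
proof -
  interpret M: module R M by fact
  interpret N: module R N by fact
  have k: "Poly_Mapping.keys (a - b) \<subseteq> S" if "Poly_Mapping.keys a \<subseteq> S" "Poly_Mapping.keys b \<subseteq> S" for a b :: "'x \<Rightarrow>\<^sub>0 int" and S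
    using that keys_diff by fastforce
  have f: "Poly_Mapping.keys (frag_of (a, b)) \<subseteq> carrier M \<times> carrier N"
    if "a \<in> carrier M" "b \<in> carrier N" for a b using that by simp
  show ?thesis
    unfolding tensor_relators_def
    by (rule subsetI, elim UnE CollectE exE conjE, simp_all only: carrier_free_Abelian_group_iff)
      (intro k f; simp)+
qed

lemma tensor_rel_subgroup:
  assumes "module R M" "module R N"
  shows "subgroup (tensor_rel R M N) (pair_sums M N)"
  unfolding tensor_rel_def
  by (rule group.generate_is_subgroup[OF group_free_Abelian_group tensor_relators_subset[OF assms]])

lemma tensor_rel_props:
  assumes "module R M" "module R N"
  shows "0 \<in> tensor_rel R M N"
    "\<And>x y. x \<in> tensor_rel R M N \<Longrightarrow> y \<in> tensor_rel R M N \<Longrightarrow> x + y \<in> tensor_rel R M N"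
    "\<And>x. x \<in> tensor_rel R M N \<Longrightarrow> - x \<in> tensor_rel R M N"
    "\<And>x y. x \<in> tensor_rel R M N \<Longrightarrow> y \<in> tensor_rel R M N \<Longrightarrow> x - y \<in> tensor_rel R M N"
    "tensor_rel R M N \<subseteq> carrier (pair_sums M N)"
proof -
  note s = tensor_rel_subgroup[OF assms]
  show 1: "0 \<in> tensor_rel R M N" using subgroup.one_closed[OF s] by simp
  show 2: "x + y \<in> tensor_rel R M N" if "x \<in> tensor_rel R M N" "y \<in> tensor_rel R M N" for x y
    using subgroup.m_closed[OF s that] by simp
  show 5: "tensor_rel R M N \<subseteq> carrier (pair_sums M N)" using subgroup.subset[OF s] .
  show 3: "- x \<in> tensor_rel R M N" if "x \<in> tensor_rel R M N" for x
  proof -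
    have "Poly_Mapping.keys x \<subseteq> carrier M \<times> carrier N"
      using subsetD[OF 5 that] by (simp only: carrier_free_Abelian_group_iff)
    from subgroup.m_inv_closed[OF s that] show ?thesis
      unfolding inv_free_Abelian_group[OF \<open>Poly_Mapping.keys x \<subseteq> _\<close>] .
  qed
  show "x - y \<in> tensor_rel R M N" if "x \<in> tensor_rel R M N" "y \<in> tensor_rel R M N" for x y
    using 2[OF that(1) 3[OF that(2)]] by simp
qed

lemma tensor_class_eq: "tensor_class R M N x = (\<lambda>h. h + x) ` tensor_rel R M N"
  by (auto simp: tensor_class_def r_coset_def)

lemma tensor_class_eq_iff:
  assumes "module R M" "module R N"
  shows "tensor_class R M N x = tensor_class R M N y \<longleftrightarrow> x - y \<in> tensor_rel R M N"
proof
  assume "tensor_class R M N x = tensor_class R M N y"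
  moreover have "x \<in> tensor_class R M N x"
    using tensor_rel_props(1)[OF assms] by (force simp: tensor_class_eq)
  ultimately obtain h where "h \<in> tensor_rel R M N" "x = h + y" by (auto simp: tensor_class_eq)
  then show "x - y \<in> tensor_rel R M N" by simp
next
  assume d: "x - y \<in> tensor_rel R M N"
  have "h + x \<in> (\<lambda>h. h + y) ` tensor_rel R M N" if "h \<in> tensor_rel R M N" for h
    using tensor_rel_props(2)[OF assms that d] by (force simp: image_iff algebra_simps)
  moreover have "h + y \<in> (\<lambda>h. h + x) ` tensor_rel R M N" if "h \<in> tensor_rel R M N" for h
    using tensor_rel_props(4)[OF assms that d] by (force simp: image_iff algebra_simps)
  ultimately show "tensor_class R M N x = tensor_class R M N y"
    by (auto simp: tensor_class_eq)
qed

definition respects_tensor ::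
  "('r, 'k) ring_scheme \<Rightarrow> ('r, 'a, 'm) module_scheme \<Rightarrow> ('r, 'b, 'n) module_scheme
    \<Rightarrow> ('a \<times> 'b \<Rightarrow> 'a \<times> 'b) \<Rightarrow> bool" where
  "respects_tensor R M N f \<longleftrightarrow>
    (\<forall>x\<in>tensor_rel R M N. frag_extend (\<lambda>p. frag_of (f p)) x \<in> tensor_rel R M N)"

lemma respects_tensorI:
  assumes m: "module R M" "module R N"
    and r: "\<And>x. x \<in> tensor_relators R M N \<Longrightarrow> frag_extend (\<lambda>p. frag_of (f p)) x \<in> tensor_rel R M N"
  shows "respects_tensor R M N f"
  unfolding respects_tensor_def
proof
  fix x assume "x \<in> tensor_rel R M N"
  then show "frag_extend (\<lambda>p. frag_of (f p)) x \<in> tensor_rel R M N"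
    unfolding tensor_rel_def
  proof (induction rule: generate.induct)
    case one then show ?case using tensor_rel_props(1)[OF m] by (simp add: tensor_rel_def)
  next
    case (incl h) then show ?case using r by (simp add: tensor_rel_def)
  next
    case (inv h) 
    then have "Poly_Mapping.keys h \<subseteq> carrier M \<times> carrier N"
      using subsetD[OF tensor_relators_subset[OF m]] by (simp only: carrier_free_Abelian_group_iff)
    then show ?case
      using tensor_rel_props(3)[OF m r[OF inv]]
      by (simp only: inv_free_Abelian_group frag_extend_minus tensor_rel_def)
  next
    case (eng h1 h2) then show ?case using tensor_rel_props(2)[OF m]
      by (simp add: tensor_rel_def frag_extend_add)
  qed
qed

lemma tensor_action_class:
  assumes m: "module R M" "module R N" and r: "respects_tensor R M N f"
  shows "tensor_action R M N f (tensor_class R M N x) =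
    tensor_class R M N (frag_extend (\<lambda>p. frag_of (f p)) x)"
proof -
  have "tensor_class R M N (frag_extend (\<lambda>p. frag_of (f p)) (h + x)) =
      tensor_class R M N (frag_extend (\<lambda>p. frag_of (f p)) x)" if "h \<in> tensor_rel R M N" for h
    unfolding tensor_class_eq_iff[OF m] using r that
    by (simp add: frag_extend_add respects_tensor_def)
  then show ?thesis
    unfolding tensor_action_def tensor_class_eq[of R M N x]
    using tensor_rel_props(1)[OF m] by auto
qed

lemma respects_tensor_pair:
  assumes m: "module R M" "module R N"
    and g: "\<And>a. a \<in> carrier M \<Longrightarrow> g a \<in> carrier M"
      "\<And>a b. a \<in> carrier M \<Longrightarrow> b \<in> carrier M \<Longrightarrow> g (a \<oplus>\<^bsub>M\<^esub> b) = g a \<oplus>\<^bsub>M\<^esub> g b"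
      "\<And>r a. r \<in> carrier R \<Longrightarrow> a \<in> carrier M \<Longrightarrow> g (r \<odot>\<^bsub>M\<^esub> a) = r \<odot>\<^bsub>M\<^esub> g a"
    and h: "\<And>a. a \<in> carrier N \<Longrightarrow> h a \<in> carrier N"
      "\<And>a b. a \<in> carrier N \<Longrightarrow> b \<in> carrier N \<Longrightarrow> h (a \<oplus>\<^bsub>N\<^esub> b) = h a \<oplus>\<^bsub>N\<^esub> h b"
      "\<And>r a. r \<in> carrier R \<Longrightarrow> a \<in> carrier N \<Longrightarrow> h (r \<odot>\<^bsub>N\<^esub> a) = r \<odot>\<^bsub>N\<^esub> h a"
  shows "respects_tensor R M N (\<lambda>(a, b). (g a, h b))"
proof (rule respects_tensorI[OF m])
  fix x assume "x \<in> tensor_relators R M N"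
  then have "frag_extend (\<lambda>p. frag_of (case p of (a, b) \<Rightarrow> (g a, h b))) x \<in> tensor_relators R M N"
    unfolding tensor_relators_def
    by (elim UnE CollectE exE conjE; simp add: frag_extend_diff g(2,3) h(2,3)) (use g(1) h(1) in blast)+
  then show "frag_extend (\<lambda>p. frag_of (case p of (a, b) \<Rightarrow> (g a, h b))) x \<in> tensor_rel R M N"
    unfolding tensor_rel_def by (rule generate.incl)
qed

abbreviation frag_mult where
  "frag_mult M N x y \<equiv>
    frag_extend (\<lambda>(a, b). frag_extend (\<lambda>(a', b'). frag_of (a \<otimes>\<^bsub>M\<^esub> a', b \<otimes>\<^bsub>N\<^esub> b')) y) x"

lemma frag_mult_add_right:
  "frag_mult M N x (y + z) = frag_mult M N x y + frag_mult M N x z"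
  using subset_UNIV[of "Poly_Mapping.keys x"]
proof (induction x rule: frag_induction)
  case zero then show ?case by simp
next
  case (one x) then show ?case by (simp add: frag_extend_add split: prod.split)
next
  case (diff a b) then show ?case by (simp only: frag_extend_diff) simp
qed

lemma frag_mult_diff_right:
  "frag_mult M N x (y - z) = frag_mult M N x y - frag_mult M N x z"
  using frag_mult_add_right[where y = "y - z" and z = z and x = x and M = M and N = N] by (simp only: diff_add_cancel eq_diff_eq)

lemma frag_mult_rel:
  assumes M: "nonassoc_algebra R M" and N: "nonassoc_algebra R N"
    and x: "x \<in> tensor_rel R M N" and y: "y \<in> carrier (pair_sums M N)"
  shows "frag_mult M N x y \<in> tensor_rel R M N" "frag_mult M N y x \<in> tensor_rel R M N"
proof -
  interpret M: nonassoc_algebra R M by fact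
  interpret N: nonassoc_algebra R N by fact
  have m: "module R M" "module R N" by unfold_locales
  have y': "Poly_Mapping.keys y \<subseteq> carrier M \<times> carrier N" using y by simp
  show "frag_mult M N x y \<in> tensor_rel R M N"
    using y'
  proof (induction y rule: frag_induction)
    case zero then show ?case by (simp add: tensor_rel_props(1)[OF m] frag_extend_eq_0 split: prod.splits)
  next
    case (one p)
    obtain c d where p: "p = (c, d)" "c \<in> carrier M" "d \<in> carrier N" using one by auto
    have "respects_tensor R M N (\<lambda>(a, b). (a \<otimes>\<^bsub>M\<^esub> c, b \<otimes>\<^bsub>N\<^esub> d))"
      by (rule respects_tensor_pair[OF m])
        (use p in \<open>auto simp: M.prod_closed N.prod_closed M.prod_add_left N.prod_add_left
          M.prod_smult_left N.prod_smult_left\<close>)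
    then show ?case using x by (simp add: p respects_tensor_def case_prod_unfold)
  next
    case (diff a b) then show ?case
      by (simp only: frag_mult_diff_right tensor_rel_props(4)[OF m])
  qed
  show "frag_mult M N y x \<in> tensor_rel R M N"
    using y'
  proof (induction y rule: frag_induction)
    case zero then show ?case by (simp add: tensor_rel_props(1)[OF m])
  next
    case (one p)
    obtain c d where p: "p = (c, d)" "c \<in> carrier M" "d \<in> carrier N" using one by auto
    have "respects_tensor R M N (\<lambda>(a, b). (c \<otimes>\<^bsub>M\<^esub> a, d \<otimes>\<^bsub>N\<^esub> b))"
      by (rule respects_tensor_pair[OF m])
        (use p in \<open>auto simp: M.prod_closed N.prod_closed M.prod_add_right N.prod_add_right
          M.prod_smult_right N.prod_smult_right\<close>)
    then show ?case using x by (simp add: p respects_tensor_def case_prod_unfold)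
  next
    case (diff a b) then show ?case
      by (simp only: frag_extend_diff tensor_rel_props(4)[OF m])
  qed
qed

lemma tensor_mult_class:
  assumes M: "nonassoc_algebra R M" and N: "nonassoc_algebra R N"
    and xy: "x \<in> carrier (pair_sums M N)" "y \<in> carrier (pair_sums M N)"
  shows "tensor_mult R M N (tensor_class R M N x) (tensor_class R M N y) =
    tensor_class R M N (frag_mult M N x y)"
proof -
  have m: "module R M" "module R N"
    using M N by (auto simp: nonassoc_algebra_def)
  have "tensor_class R M N (frag_mult M N (h + x) (k + y)) =
      tensor_class R M N (frag_mult M N x y)"
    if "h \<in> tensor_rel R M N" "k \<in> tensor_rel R M N" for h k
  proof -
    have "k \<in> carrier (pair_sums M N)" using tensor_rel_props(5)[OF m] that by blast
    then have "frag_mult M N h k + frag_mult M N h y + frag_mult M N x k \<in> tensor_rel R M N"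
      by (intro tensor_rel_props(2)[OF m] frag_mult_rel[OF M N] that xy)
    moreover have "frag_mult M N (h + x) (k + y) - frag_mult M N x y =
        frag_mult M N h k + frag_mult M N h y + frag_mult M N x k"
      unfolding frag_mult_add_right unfolding frag_extend_add
      by (simp only: add_diff_eq diff_eq_eq ac_simps)
    ultimately show ?thesis
      unfolding tensor_class_eq_iff[OF m] by (simp only:)
  qed
  then show ?thesis
    unfolding tensor_mult_def tensor_class_eq[of R M N x] tensor_class_eq[of R M N y]
    using tensor_rel_props(1)[OF m] by auto
qed

lemma tensor_algebra_mult_pure:
  assumes "nonassoc_algebra R M" and "nonassoc_algebra R N"
    and "a \<in> carrier M" "a' \<in> carrier M" "b \<in> carrier N" "b' \<in> carrier N"
  shows "pure_tensor R M N a b \<otimes>\<^bsub>tensor_algebra R M N\<^esub> pure_tensor R M N a' b' =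
    pure_tensor R M N (a \<otimes>\<^bsub>M\<^esub> a') (b \<otimes>\<^bsub>N\<^esub> b')"
  using assms by (simp add: tensor_algebra_def pure_tensor_def tensor_mult_class)

lemma tensor_algebra_smult_pure:
  assumes m: "module R M" "module R N" and r: "r \<in> carrier R"
  shows "r \<odot>\<^bsub>tensor_algebra R M N\<^esub> pure_tensor R M N a b = pure_tensor R M N (r \<odot>\<^bsub>M\<^esub> a) b"
proof -
  interpret M: module R M by fact
  have "respects_tensor R M N (\<lambda>(a, b). (r \<odot>\<^bsub>M\<^esub> a, b))"
    by (rule respects_tensor_pair[OF m])
      (use r in \<open>auto simp: M.smult_r_distr M.smult_assoc1[symmetric] M.R.m_comm\<close>)
  then show ?thesis
    by (simp add: tensor_algebra_def pure_tensor_def tensor_action_class[OF m])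
qed

lemma base_change_smult_pure:
  assumes M: "module R M" and B: "algebra R B" and s: "s \<in> carrier B"
  shows "s \<odot>\<^bsub>base_change R M B\<^esub> pure_tensor R M B a b = pure_tensor R M B a (s \<otimes>\<^bsub>B\<^esub> b)"
proof -
  interpret B: nonassoc_algebra R B by (rule algebra_imp_nonassoc_algebra[OF B])
  have m: "module R B" by unfold_locales
  have "respects_tensor R M B (\<lambda>(a, b). (a, s \<otimes>\<^bsub>B\<^esub> b))"
    by (rule respects_tensor_pair[OF M m])
      (use s in \<open>auto simp: B.prod_closed B.prod_add_right B.prod_smult_right\<close>)
  then show ?thesis
    by (simp add: base_change_def with_smult_def pure_tensor_def tensor_action_class[OF M m])
qed

end

theory Submission
  imports Defs
begin

text \<open>
  Over a field, \<open>A \<otimes> B\<close> is central as a \<open>B\<close>-algebra: expanding \<open>\<psi> (a \<otimes> 1)\<close> in a basis of \<open>B\<close>,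
  every coordinate of a centroid element \<open>\<psi>\<close> lies in the centroid of \<open>A\<close>, hence is a scalar. The
  isomorphism makes \<open>L \<otimes>\<^sub>C B\<close> central too. Let \<open>p : B \<rightarrow> C\<close> be the coordinate of the basis element \<open>1\<close>.
  If \<open>\<chi>\<close> is a \<open>C\<close>-linear centroid element of \<open>L\<close>, then \<open>\<chi> \<otimes> id\<close> is multiplication by some \<open>b\<close>,
  and applying \<open>x \<otimes> c \<mapsto> p c \<odot> x\<close> to \<open>\<chi> x \<otimes> 1 = x \<otimes> b\<close> gives \<open>\<chi> x = p b \<odot> x\<close>. The same map shows that
  \<open>L\<close> inherits perfectness, which forces \<open>F\<close>-linear centroid elements of \<open>L\<close> to be \<open>C\<close>-linear.
\<close>

section \<open>Bases and coordinates\<close>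

text \<open>Two difficulties shape the argument. The first is finiteness: each
  \<open>\<psi> (a \<otimes> 1)\<close> has only finitely many nonzero coordinates, but the support
  might grow with \<open>a\<close>. Centrality of \<open>A\<close> turns the coordinate at a basis
  element into one scalar valid for all \<open>a\<close>, so a single nonzero \<open>a\<close>
  bounds all supports at once. The second is that three scalar rings occur, and a centroid depends
  on its scalars. The proof goes up from F to B, across the given isomorphism, and down from B to C;
  only then does it compare C-linear with F-linear maps on L. Centrality and perfectness are carried
  along by any isomorphism, so no control over the image of L in \<open>A \<otimes> B\<close> is
  required. Freeness with 1 in the basis enters as a C-linear \<open>p\<close> with
  \<open>p 1 = 1\<close>: then \<open>x \<otimes> c \<mapsto> p c \<odot> x\<close> is a left
  inverse of \<open>x \<mapsto> x \<otimes> 1\<close>, and this brings statements about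
  \<open>L \<otimes> B\<close> back to L. C-linearity on products is the identity
  \<open>\<chi> (c (x y)) = (c x) \<chi> y = c \<chi> (x y)\<close>. Conversely, C-linear maps are
  F-linear because r in F acts as the element \<open>r 1\<close> of C.\<close>

lemma (in module) finsum_smult_add:
  assumes "finite S" "S \<subseteq> carrier M" "f \<in> S \<rightarrow> carrier R" "g \<in> S \<rightarrow> carrier R"
  shows "(\<Oplus>\<^bsub>M\<^esub>x\<in>S. (f x \<oplus> g x) \<odot>\<^bsub>M\<^esub> x) = (\<Oplus>\<^bsub>M\<^esub>x\<in>S. f x \<odot>\<^bsub>M\<^esub> x) \<oplus>\<^bsub>M\<^esub> (\<Oplus>\<^bsub>M\<^esub>x\<in>S. g x \<odot>\<^bsub>M\<^esub> x)"
proof -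
  have "(\<Oplus>\<^bsub>M\<^esub>x\<in>S. (f x \<oplus> g x) \<odot>\<^bsub>M\<^esub> x) = (\<Oplus>\<^bsub>M\<^esub>x\<in>S. f x \<odot>\<^bsub>M\<^esub> x \<oplus>\<^bsub>M\<^esub> g x \<odot>\<^bsub>M\<^esub> x)"
    using assms by (intro M.finsum_cong') (auto simp: smult_l_distr Pi_iff subset_iff)
  also have "\<dots> = (\<Oplus>\<^bsub>M\<^esub>x\<in>S. f x \<odot>\<^bsub>M\<^esub> x) \<oplus>\<^bsub>M\<^esub> (\<Oplus>\<^bsub>M\<^esub>x\<in>S. g x \<odot>\<^bsub>M\<^esub> x)"
    using assms by (intro M.finsum_addf) (auto simp: Pi_iff subset_iff)
  finally show ?thesis .
qed

lemma (in module) finsum_smult_smult: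
  assumes "finite S" "S \<subseteq> carrier M" "f \<in> S \<rightarrow> carrier R" "r \<in> carrier R"
  shows "(\<Oplus>\<^bsub>M\<^esub>x\<in>S. (r \<otimes> f x) \<odot>\<^bsub>M\<^esub> x) = r \<odot>\<^bsub>M\<^esub> (\<Oplus>\<^bsub>M\<^esub>x\<in>S. f x \<odot>\<^bsub>M\<^esub> x)"
proof -
  have "r \<odot>\<^bsub>M\<^esub> (\<Oplus>\<^bsub>M\<^esub>x\<in>S. f x \<odot>\<^bsub>M\<^esub> x) = (\<Oplus>\<^bsub>M\<^esub>x\<in>S. r \<odot>\<^bsub>M\<^esub> (f x \<odot>\<^bsub>M\<^esub> x))"
    using assms by (intro finsum_smult_ldistr) (auto simp: Pi_iff subset_iff)
  also have "\<dots> = (\<Oplus>\<^bsub>M\<^esub>x\<in>S. (r \<otimes> f x) \<odot>\<^bsub>M\<^esub> x)"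
    using assms by (intro M.finsum_cong') (auto simp: smult_assoc1 Pi_iff subset_iff)
  finally show ?thesis by simp
qed

lemma (in module) finsum_smult_mono:
  assumes "finite T" "S \<subseteq> T" "T \<subseteq> carrier M" "f \<in> T \<rightarrow> carrier R" "\<And>x. x \<in> T - S \<Longrightarrow> f x = \<zero>"
  shows "(\<Oplus>\<^bsub>M\<^esub>x\<in>S. f x \<odot>\<^bsub>M\<^esub> x) = (\<Oplus>\<^bsub>M\<^esub>x\<in>T. f x \<odot>\<^bsub>M\<^esub> x)"
  using assms by (intro M.add.finprod_mono_neutral_cong_left) (auto simp: Pi_iff subset_iff)

text \<open>For each \<open>m\<close> some representing function is chosen. Representing functions
  are closed under sums and scalar multiples, and two of them for the same \<open>m\<close> agree on
  \<open>X\<close>, so the choice is automatically additive and linear. Off \<open>X\<close> the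
  values of \<open>k m\<close> are arbitrary, which is why every conclusion is restricted to
  \<open>X\<close>.\<close>

lemma (in module) basis_coordinates:
  assumes X: "module_basis R M X"
  obtains k where "\<And>m x. m \<in> carrier M \<Longrightarrow> x \<in> X \<Longrightarrow> k m x \<in> carrier R"
    and "\<And>m n x. m \<in> carrier M \<Longrightarrow> n \<in> carrier M \<Longrightarrow> x \<in> X \<Longrightarrow> k (m \<oplus>\<^bsub>M\<^esub> n) x = k m x \<oplus> k n x"
    and "\<And>r m x. r \<in> carrier R \<Longrightarrow> m \<in> carrier M \<Longrightarrow> x \<in> X \<Longrightarrow> k (r \<odot>\<^bsub>M\<^esub> m) x = r \<otimes> k m x"
    and "\<And>x. x \<in> X \<Longrightarrow> k x x = \<one>"
    and "\<And>m. m \<in> carrier M \<Longrightarrow> \<exists>S. finite S \<and> S \<subseteq> X \<and> (\<forall>x\<in>X - S. k m x = \<zero>) \<and>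
      m = (\<Oplus>\<^bsub>M\<^esub>x\<in>S. k m x \<odot>\<^bsub>M\<^esub> x)"
proof -
  define rep where "rep m f \<longleftrightarrow> f \<in> X \<rightarrow> carrier R \<and> (\<exists>S. finite S \<and> S \<subseteq> X \<and>
    (\<forall>x\<in>X - S. f x = \<zero>) \<and> m = (\<Oplus>\<^bsub>M\<^esub>x\<in>S. f x \<odot>\<^bsub>M\<^esub> x))" for m f
  have XM: "X \<subseteq> carrier M" and ind: "lin_indep R M X" and span: "lin_span R M X = carrier M"
    using X by (auto simp: module_basis_def)
  have rep_closed: "f x \<in> carrier R" if "rep m f" "x \<in> X" for m f x
    using that by (auto simp: rep_def)
  have rep_carrier: "m \<in> carrier M" if "rep m f" for m f
    using that XM unfolding rep_def by (fastforce intro!: M.finsum_closed)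
  \<comment> \<open>Two finite supports are enlarged to their union, so that both sums run over one
    index set and combine term by term.\<close>
  have common: "\<exists>T. finite T \<and> T \<subseteq> X \<and> (\<forall>x\<in>X - T. f x = \<zero> \<and> g x = \<zero>) \<and>
      m = (\<Oplus>\<^bsub>M\<^esub>x\<in>T. f x \<odot>\<^bsub>M\<^esub> x) \<and> n = (\<Oplus>\<^bsub>M\<^esub>x\<in>T. g x \<odot>\<^bsub>M\<^esub> x)"
    if f: "rep m f" and g: "rep n g" for m n f g
  proof -
    obtain S where S: "finite S" "S \<subseteq> X" "\<And>x. x \<in> X - S \<Longrightarrow> f x = \<zero>" "m = (\<Oplus>\<^bsub>M\<^esub>x\<in>S. f x \<odot>\<^bsub>M\<^esub> x)"
      using f by (auto simp: rep_def)
    obtain S' where S': "finite S'" "S' \<subseteq> X" "\<And>x. x \<in> X - S' \<Longrightarrow> g x = \<zero>" "n = (\<Oplus>\<^bsub>M\<^esub>x\<in>S'. g x \<odot>\<^bsub>M\<^esub> x)"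
      using g by (auto simp: rep_def)
    have "m = (\<Oplus>\<^bsub>M\<^esub>x\<in>S \<union> S'. f x \<odot>\<^bsub>M\<^esub> x)" unfolding S(4)
      using S S' XM by (intro finsum_smult_mono) (auto intro: rep_closed[OF f])
    moreover have "n = (\<Oplus>\<^bsub>M\<^esub>x\<in>S \<union> S'. g x \<odot>\<^bsub>M\<^esub> x)" unfolding S'(4)
      using S S' XM by (intro finsum_smult_mono) (auto intro: rep_closed[OF g])
    ultimately show ?thesis using S S' by (intro exI[of _ "S \<union> S'"]) auto
  qed
  have rep_add: "rep (m \<oplus>\<^bsub>M\<^esub> n) (\<lambda>x. f x \<oplus> g x)" if f: "rep m f" and g: "rep n g" for m n f g
  proof -
    obtain T where T: "finite T" "T \<subseteq> X" "\<And>x. x \<in> X - T \<Longrightarrow> f x = \<zero> \<and> g x = \<zero>"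
      and mn: "m = (\<Oplus>\<^bsub>M\<^esub>x\<in>T. f x \<odot>\<^bsub>M\<^esub> x)" "n = (\<Oplus>\<^bsub>M\<^esub>x\<in>T. g x \<odot>\<^bsub>M\<^esub> x)"
      using common[OF f g] by blast
    have "m \<oplus>\<^bsub>M\<^esub> n = (\<Oplus>\<^bsub>M\<^esub>x\<in>T. (f x \<oplus> g x) \<odot>\<^bsub>M\<^esub> x)" unfolding mn
      by (rule finsum_smult_add[symmetric]) (use T XM rep_closed[OF f] rep_closed[OF g] in auto)
    then show ?thesis unfolding rep_def
      using T rep_closed[OF f] rep_closed[OF g] by (intro conjI exI[of _ T]) auto
  qed
  have rep_smult: "rep (r \<odot>\<^bsub>M\<^esub> m) (\<lambda>x. r \<otimes> f x)" if f: "rep m f" and r: "r \<in> carrier R" for r m f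
  proof -
    obtain T where T: "finite T" "T \<subseteq> X" "\<And>x. x \<in> X - T \<Longrightarrow> f x = \<zero>"
      and m: "m = (\<Oplus>\<^bsub>M\<^esub>x\<in>T. f x \<odot>\<^bsub>M\<^esub> x)"
      using common[OF f f] by blast
    have "r \<odot>\<^bsub>M\<^esub> m = (\<Oplus>\<^bsub>M\<^esub>x\<in>T. (r \<otimes> f x) \<odot>\<^bsub>M\<^esub> x)" unfolding m
      by (rule finsum_smult_smult[symmetric]) (use T XM r rep_closed[OF f] in auto)
    then show ?thesis unfolding rep_def
      using T rep_closed[OF f] r by (intro conjI exI[of _ T]) auto
  qed
  have uniq: "f x = g x" if f: "rep m f" and g: "rep m g" and x: "x \<in> X" for m f g x
  proof -
    \<comment> \<open>The difference is written with the scalar -1, so that \<open>rep_add\<close>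
      and \<open>rep_smult\<close> show it to represent m - m = 0; independence then kills every
      coefficient.\<close>
    let ?h = "\<lambda>x. f x \<oplus> (\<ominus> \<one>) \<otimes> g x"
    have m: "m \<in> carrier M" by (rule rep_carrier[OF f])
    have h: "rep (m \<oplus>\<^bsub>M\<^esub> (\<ominus> \<one>) \<odot>\<^bsub>M\<^esub> m) ?h"
      by (intro rep_add rep_smult f g) simp
    have "m \<oplus>\<^bsub>M\<^esub> (\<ominus> \<one>) \<odot>\<^bsub>M\<^esub> m = \<zero>\<^bsub>M\<^esub>"
      using m by (simp add: smult_l_minus M.r_neg)
    then have h0: "rep \<zero>\<^bsub>M\<^esub> ?h" using h by simp
    obtain T where T: "finite T" "T \<subseteq> X" "\<And>x. x \<in> X - T \<Longrightarrow> ?h x = \<zero>"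
      and s: "\<zero>\<^bsub>M\<^esub> = (\<Oplus>\<^bsub>M\<^esub>x\<in>T. ?h x \<odot>\<^bsub>M\<^esub> x)"
      using common[OF h0 h0] by blast
    have hT: "?h \<in> T \<rightarrow> carrier R" using rep_closed[OF h0] T by blast
    have "\<forall>x\<in>T. ?h x = \<zero>"
      using ind T(1,2) hT s[symmetric] unfolding lin_indep_def by (elim allE[of _ T] allE[of _ ?h]) blast
    then have "?h x = \<zero>"
      using T(3) x by blast
    then show ?thesis
      using rep_closed[OF f x] rep_closed[OF g x]
      by (simp add: R.l_minus R.minus_equality R.minus_eq[symmetric])
  qed
  have ex: "\<exists>f. rep m f" if "m \<in> carrier M" for m
  proof -
    have "m \<in> lin_span R M X" using that span by simp
    then obtain S f where S: "finite S" "S \<subseteq> X" "f \<in> S \<rightarrow> carrier R" "m = (\<Oplus>\<^bsub>M\<^esub>x\<in>S. f x \<odot>\<^bsub>M\<^esub> x)"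
      unfolding lin_span_def mem_Collect_eq by (elim exE conjE)
    \<comment> \<open>\<open>lin_span\<close> controls \<open>f\<close> only on \<open>S\<close>,
      whereas \<open>rep\<close> asks for a function on all of \<open>X\<close>: extend by
      zero.\<close>
    have "(\<Oplus>\<^bsub>M\<^esub>x\<in>S. f x \<odot>\<^bsub>M\<^esub> x) = (\<Oplus>\<^bsub>M\<^esub>x\<in>S. (if x \<in> S then f x else \<zero>) \<odot>\<^bsub>M\<^esub> x)"
      using S XM by (intro M.finsum_cong') (auto simp: Pi_iff subset_iff)
    then have "rep m (\<lambda>x. if x \<in> S then f x else \<zero>)"
      unfolding rep_def using S by (auto intro!: exI[of _ S])
    then show ?thesis by blast
  qed
  define k where "k m = (SOME f. rep m f)" for m
  have k: "rep m (k m)" if "m \<in> carrier M" for m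
    unfolding k_def using someI_ex[OF ex[OF that]] .
  show thesis
  proof (rule that[of k])
    show "k m x \<in> carrier R" if "m \<in> carrier M" "x \<in> X" for m x
      using rep_closed[OF k] that .
    show "k (m \<oplus>\<^bsub>M\<^esub> n) x = k m x \<oplus> k n x" if "m \<in> carrier M" "n \<in> carrier M" "x \<in> X" for m n x
      using that by (intro uniq[OF k rep_add[OF k k]]) auto
    show "k (r \<odot>\<^bsub>M\<^esub> m) x = r \<otimes> k m x" if "r \<in> carrier R" "m \<in> carrier M" "x \<in> X" for r m x
      using that by (intro uniq[OF k rep_smult[OF k]]) auto
    show "k x x = \<one>" if "x \<in> X" for x
    proof -
      \<comment> \<open>The indicator of \<open>x\<close> represents \<open>x\<close>, so by
        uniqueness the chosen coordinates of \<open>x\<close> coincide with it.\<close>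
      have "rep x (\<lambda>y. if y = x then \<one> else \<zero>)"
        unfolding rep_def using that XM by (auto intro!: exI[of _ "{x}"] simp: M.finsum_insert)
      from uniq[OF k this that] show ?thesis using that XM by auto
    qed
    show "\<exists>S. finite S \<and> S \<subseteq> X \<and> (\<forall>x\<in>X - S. k m x = \<zero>) \<and> m = (\<Oplus>\<^bsub>M\<^esub>x\<in>S. k m x \<odot>\<^bsub>M\<^esub> x)"
      if "m \<in> carrier M" for m
      using k[OF that] by (auto simp: rep_def)
  qed
qed

text \<open>A maximal independent set, from Zorn's lemma, spans: adjoining a vector outside the span
  creates a linear relation in which the new vector has a nonzero, hence invertible, coefficient,
  and solving for that vector places it in the span after all.\<close>

lemma vector_space_has_basis:
  assumes F: "field R" and M: "module R M"
  obtains X where "module_basis R M X"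
proof -
  interpret R: field R by fact
  interpret module R M by fact
  let ?I = "{X. X \<subseteq> carrier M \<and> lin_indep R M X}"
  have "\<Union>\<C> \<in> ?I" if c: "subset.chain ?I \<C>" for \<C>
  \<comment> \<open>A finite subset of the union lies in one member of the chain only if the chain
    has a member; the union of the empty chain is the empty set, which is independent.\<close>
  proof (cases "\<C> = {}")
    case True then show ?thesis by (auto simp: lin_indep_def)
  next
    case False
    have \<C>: "\<C> \<subseteq> ?I" using c by (simp add: subset_chain_def)
    have "\<forall>x\<in>S. f x = \<zero>\<^bsub>R\<^esub>"
      if S: "finite S" "S \<subseteq> \<Union>\<C>" "f \<in> S \<rightarrow> carrier R" "(\<Oplus>\<^bsub>M\<^esub>x\<in>S. f x \<odot>\<^bsub>M\<^esub> x) = \<zero>\<^bsub>M\<^esub>" for S f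
    proof -
      obtain X where X: "X \<in> \<C>" "S \<subseteq> X"
        using finite_subset_Union_chain[OF S(1,2) False c] .
      then have "lin_indep R M X" using \<C> by auto
      then show ?thesis using S X unfolding lin_indep_def by blast
    qed
    then show ?thesis using \<C> unfolding lin_indep_def by blast
  qed
  from subset_Zorn'[of ?I, OF this]
  obtain X where XM: "X \<subseteq> carrier M" and ind: "lin_indep R M X"
    and max: "\<And>Y. Y \<subseteq> carrier M \<Longrightarrow> lin_indep R M Y \<Longrightarrow> X \<subseteq> Y \<Longrightarrow> Y = X"
    by auto
  have "m \<in> lin_span R M X" if m: "m \<in> carrier M" for m
  proof (rule ccontr)
    assume n: "m \<notin> lin_span R M X"
    have "m \<in> lin_span R M X" if "m \<in> X"
    proof -
      have "m = (\<Oplus>\<^bsub>M\<^esub>x\<in>{m}. \<one>\<^bsub>R\<^esub> \<odot>\<^bsub>M\<^esub> x)" using m by (simp add: M.finsum_insert)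
      then show ?thesis using that unfolding lin_span_def
        by (intro CollectI exI[of _ "{m}"] exI[of _ "\<lambda>_. \<one>\<^bsub>R\<^esub>"]) auto
    qed
    then have mX: "m \<notin> X" using n by blast
    then have "\<not> lin_indep R M (insert m X)" using max[of "insert m X"] XM m by blast
    then obtain S f where S: "finite S" "S \<subseteq> insert m X" "f \<in> S \<rightarrow> carrier R"
      and s0: "(\<Oplus>\<^bsub>M\<^esub>x\<in>S. f x \<odot>\<^bsub>M\<^esub> x) = \<zero>\<^bsub>M\<^esub>" and nz: "\<exists>x\<in>S. f x \<noteq> \<zero>\<^bsub>R\<^esub>"
      unfolding lin_indep_def by blast
    have mS: "m \<in> S"
    proof (rule ccontr)
      assume "m \<notin> S"
      then have "S \<subseteq> X" using S by blast
      then show False using ind S s0 nz unfolding lin_indep_def by blast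
    qed
    define T where "T = S - {m}"
    have T: "finite T" "T \<subseteq> X" "m \<notin> T" "S = insert m T" using S mS by (auto simp: T_def)
    have f: "f m \<in> carrier R" "f \<in> T \<rightarrow> carrier R" using S T by auto
    have sT: "(\<Oplus>\<^bsub>M\<^esub>x\<in>T. f x \<odot>\<^bsub>M\<^esub> x) \<in> carrier M"
      using f T XM by (intro M.finsum_closed) auto
    have s1: "f m \<odot>\<^bsub>M\<^esub> m \<oplus>\<^bsub>M\<^esub> (\<Oplus>\<^bsub>M\<^esub>x\<in>T. f x \<odot>\<^bsub>M\<^esub> x) = \<zero>\<^bsub>M\<^esub>"
      using s0 f T XM m unfolding T(4) by (subst (asm) M.finsum_insert) auto
    \<comment> \<open>Were this coefficient zero, the relation would involve elements of
      \<open>X\<close> only and would be trivial.\<close>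
    have fm: "f m \<noteq> \<zero>\<^bsub>R\<^esub>"
    proof
      assume z: "f m = \<zero>\<^bsub>R\<^esub>"
      then have "(\<Oplus>\<^bsub>M\<^esub>x\<in>T. f x \<odot>\<^bsub>M\<^esub> x) = \<zero>\<^bsub>M\<^esub>" using s1 sT m by simp
      then have "\<forall>x\<in>T. f x = \<zero>\<^bsub>R\<^esub>" using ind T f unfolding lin_indep_def by blast
      then show False using z nz T by auto
    qed
    define r where "r = \<ominus>\<^bsub>R\<^esub> (inv\<^bsub>R\<^esub> (f m))"
    have i: "inv\<^bsub>R\<^esub> (f m) \<in> carrier R" "inv\<^bsub>R\<^esub> (f m) \<otimes>\<^bsub>R\<^esub> f m = \<one>\<^bsub>R\<^esub>"
      using fm f by (auto simp: R.field_Units)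
    have r: "r \<in> carrier R" using i by (simp add: r_def)
    have "f m \<odot>\<^bsub>M\<^esub> m = \<ominus>\<^bsub>M\<^esub> (\<Oplus>\<^bsub>M\<^esub>x\<in>T. f x \<odot>\<^bsub>M\<^esub> x)"
      using s1 sT f m by (simp add: M.minus_equality)
    then have "inv\<^bsub>R\<^esub> (f m) \<odot>\<^bsub>M\<^esub> (f m \<odot>\<^bsub>M\<^esub> m) = r \<odot>\<^bsub>M\<^esub> (\<Oplus>\<^bsub>M\<^esub>x\<in>T. f x \<odot>\<^bsub>M\<^esub> x)"
      using i sT by (simp add: r_def smult_l_minus smult_r_minus)
    also have "inv\<^bsub>R\<^esub> (f m) \<odot>\<^bsub>M\<^esub> (f m \<odot>\<^bsub>M\<^esub> m) = m"
      using i f m by (simp add: smult_assoc1[symmetric])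
    also have "r \<odot>\<^bsub>M\<^esub> (\<Oplus>\<^bsub>M\<^esub>x\<in>T. f x \<odot>\<^bsub>M\<^esub> x) = (\<Oplus>\<^bsub>M\<^esub>x\<in>T. (r \<otimes>\<^bsub>R\<^esub> f x) \<odot>\<^bsub>M\<^esub> x)"
      by (rule finsum_smult_smult[symmetric]) (use T XM f r in auto)
    finally have "m \<in> lin_span R M X"
      unfolding lin_span_def using T f r
      by (intro CollectI exI[of _ T] exI[of _ "\<lambda>x. r \<otimes>\<^bsub>R\<^esub> f x"]) auto
    with n show False ..
  qed
  moreover have "lin_span R M X \<subseteq> carrier M"
    unfolding lin_span_def using XM by (auto intro!: M.finsum_closed)
  ultimately have "module_basis R M X"
    using XM ind by (auto simp: module_basis_def)
  then show thesis by (rule that)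
qed

section \<open>The tensor product of modules\<close>

lemma keys_add_subset:
  "Poly_Mapping.keys x \<subseteq> S \<Longrightarrow> Poly_Mapping.keys y \<subseteq> S \<Longrightarrow> Poly_Mapping.keys (x + y) \<subseteq> S"
  using keys_add[of x y] by blast

lemma keys_frag_extend_subset:
  "(\<And>p. p \<in> Poly_Mapping.keys x \<Longrightarrow> Poly_Mapping.keys (f p) \<subseteq> S) \<Longrightarrow> Poly_Mapping.keys (frag_extend f x) \<subseteq> S"
  by (rule order_trans[OF keys_frag_extend UN_least])

context
  fixes R :: "('r, 'k) ring_scheme" and M :: "('r, 'a, 'm) module_scheme"
    and N :: "('r, 'b, 'n) module_scheme"
  assumes M: "module R M" and N: "module R N"
begin

interpretation M: module R M by (rule M)
interpretation N: module R N by (rule N)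

private abbreviation (input) "TT \<equiv> tensor_algebra R M N"
private abbreviation (input) "cls \<equiv> tensor_class R M N"
private abbreviation (input) "PS \<equiv> pair_sums M N"

lemma tensor_carrier: "carrier TT = cls ` carrier PS"
  by (simp add: tensor_algebra_def carrier_FactGroup tensor_class_def)

lemma tensor_zero: "\<zero>\<^bsub>TT\<^esub> = cls 0"
  by (simp add: tensor_algebra_def tensor_class_eq)

lemma tensor_add:
  assumes "x \<in> carrier PS" "y \<in> carrier PS"
  shows "cls x \<oplus>\<^bsub>TT\<^esub> cls y = cls (x + y)"
proof -
  have "tensor_rel R M N \<lhd> PS"
    by (rule comm_group.subgroup_imp_normal[OF abelian_free_Abelian_group tensor_rel_subgroup[OF M N]])
  from normal.rcos_sum[OF this assms] show ?thesis
    by (simp add: tensor_algebra_def tensor_class_def)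
qed

lemma tensor_abelian_group: "abelian_group TT"
proof (rule abelian_groupI)
  have *: "x + y \<in> carrier PS" if "x \<in> carrier PS" "y \<in> carrier PS" for x y
    using that by (simp add: keys_add_subset)
  have z: "0 \<in> carrier PS" by simp
  show "x \<oplus>\<^bsub>TT\<^esub> y \<in> carrier TT" if "x \<in> carrier TT" "y \<in> carrier TT" for x y
    using that * by (auto simp: tensor_carrier tensor_add simp del: carrier_free_Abelian_group_iff)
  show "\<zero>\<^bsub>TT\<^esub> \<in> carrier TT"
    by (simp add: tensor_carrier tensor_zero)
  show "(x \<oplus>\<^bsub>TT\<^esub> y) \<oplus>\<^bsub>TT\<^esub> z = x \<oplus>\<^bsub>TT\<^esub> (y \<oplus>\<^bsub>TT\<^esub> z)"
    if "x \<in> carrier TT" "y \<in> carrier TT" "z \<in> carrier TT" for x y z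
    using that * by (auto simp: tensor_carrier tensor_add add.assoc simp del: carrier_free_Abelian_group_iff)
  show "x \<oplus>\<^bsub>TT\<^esub> y = y \<oplus>\<^bsub>TT\<^esub> x" if "x \<in> carrier TT" "y \<in> carrier TT" for x y
    using that by (auto simp: tensor_carrier tensor_add add.commute simp del: carrier_free_Abelian_group_iff)
  show "\<zero>\<^bsub>TT\<^esub> \<oplus>\<^bsub>TT\<^esub> x = x" if "x \<in> carrier TT" for x
    using that z by (auto simp: tensor_carrier tensor_add tensor_zero simp del: carrier_free_Abelian_group_iff)
  show "\<exists>y\<in>carrier TT. y \<oplus>\<^bsub>TT\<^esub> x = \<zero>\<^bsub>TT\<^esub>" if x: "x \<in> carrier TT" for x
  proof -
    obtain u where u: "x = cls u" "u \<in> carrier PS" using x by (auto simp: tensor_carrier)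
    then have u': "- u \<in> carrier PS" by simp
    then have "cls (- u) \<oplus>\<^bsub>TT\<^esub> x = \<zero>\<^bsub>TT\<^esub>" using u by (simp only: tensor_add tensor_zero) simp
    then show ?thesis using u' by (auto simp: tensor_carrier)
  qed
qed

interpretation T: abelian_group TT by (rule tensor_abelian_group)

private abbreviation (input) pure (infixl "\<otimes>\<otimes>" 75) where "a \<otimes>\<otimes> b \<equiv> pure_tensor R M N a b"

lemma pure_tensor_closed:
  "a \<in> carrier M \<Longrightarrow> b \<in> carrier N \<Longrightarrow> a \<otimes>\<otimes> b \<in> carrier TT"
  by (auto simp: pure_tensor_def tensor_carrier)

lemma tensor_relator_in_rel: "x \<in> tensor_relators R M N \<Longrightarrow> x \<in> tensor_rel R M N"
  unfolding tensor_rel_def by (rule generate.incl)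

lemma pure_tensor_add_left:
  assumes "a \<in> carrier M" "a' \<in> carrier M" "b \<in> carrier N"
  shows "(a \<oplus>\<^bsub>M\<^esub> a') \<otimes>\<otimes> b = a \<otimes>\<otimes> b \<oplus>\<^bsub>TT\<^esub> a' \<otimes>\<otimes> b"
proof -
  have "frag_of (a \<oplus>\<^bsub>M\<^esub> a', b) - frag_of (a, b) - frag_of (a', b) \<in> tensor_rel R M N"
    using assms by (intro tensor_relator_in_rel) (auto simp: tensor_relators_def)
  then have "cls (frag_of (a \<oplus>\<^bsub>M\<^esub> a', b)) = cls (frag_of (a, b) + frag_of (a', b))"
    by (simp only: tensor_class_eq_iff[OF M N] diff_diff_eq)
  also have "\<dots> = cls (frag_of (a, b)) \<oplus>\<^bsub>TT\<^esub> cls (frag_of (a', b))"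
    using assms by (simp add: tensor_add)
  finally show ?thesis by (simp add: pure_tensor_def)
qed

lemma pure_tensor_add_right:
  assumes "a \<in> carrier M" "b \<in> carrier N" "b' \<in> carrier N"
  shows "a \<otimes>\<otimes> (b \<oplus>\<^bsub>N\<^esub> b') = a \<otimes>\<otimes> b \<oplus>\<^bsub>TT\<^esub> a \<otimes>\<otimes> b'"
proof -
  have "frag_of (a, b \<oplus>\<^bsub>N\<^esub> b') - frag_of (a, b) - frag_of (a, b') \<in> tensor_rel R M N"
    using assms by (intro tensor_relator_in_rel) (auto simp: tensor_relators_def)
  then have "cls (frag_of (a, b \<oplus>\<^bsub>N\<^esub> b')) = cls (frag_of (a, b) + frag_of (a, b'))"
    by (simp only: tensor_class_eq_iff[OF M N] diff_diff_eq)
  also have "\<dots> = cls (frag_of (a, b)) \<oplus>\<^bsub>TT\<^esub> cls (frag_of (a, b'))"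
    using assms by (simp add: tensor_add)
  finally show ?thesis by (simp add: pure_tensor_def)
qed

lemma pure_tensor_balanced:
  assumes "r \<in> carrier R" "a \<in> carrier M" "b \<in> carrier N"
  shows "(r \<odot>\<^bsub>M\<^esub> a) \<otimes>\<otimes> b = a \<otimes>\<otimes> (r \<odot>\<^bsub>N\<^esub> b)"
proof -
  have "frag_of (r \<odot>\<^bsub>M\<^esub> a, b) - frag_of (a, r \<odot>\<^bsub>N\<^esub> b) \<in> tensor_rel R M N"
    using assms by (intro tensor_relator_in_rel) (auto simp: tensor_relators_def)
  then show ?thesis
    by (simp only: tensor_class_eq_iff[OF M N] pure_tensor_def)
qed

lemma pure_tensor_zero_left:
  assumes "b \<in> carrier N" shows "\<zero>\<^bsub>M\<^esub> \<otimes>\<otimes> b = \<zero>\<^bsub>TT\<^esub>"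
  using pure_tensor_add_left[of "\<zero>\<^bsub>M\<^esub>" "\<zero>\<^bsub>M\<^esub>" b] pure_tensor_closed[of "\<zero>\<^bsub>M\<^esub>" b] assms
  by simp

lemma pure_tensor_minus_left:
  assumes "a \<in> carrier M" "b \<in> carrier N" shows "(\<ominus>\<^bsub>M\<^esub> a) \<otimes>\<otimes> b = \<ominus>\<^bsub>TT\<^esub> (a \<otimes>\<otimes> b)"
  using pure_tensor_add_left[of "\<ominus>\<^bsub>M\<^esub> a" a b] assms
  by (simp add: M.M.l_neg pure_tensor_zero_left pure_tensor_closed T.minus_equality)

text \<open>Sums of pure tensors exhaust the tensor product without a case for zero or for
  negatives: zero is \<open>0 \<otimes> 0\<close>, and the negative of \<open>a \<otimes> b\<close>
  is \<open>(-a) \<otimes> b\<close>, again pure.\<close>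

lemma tensor_induct [consumes 1, case_names pure add]:
  assumes t: "t \<in> carrier TT"
    and pure: "\<And>a b. a \<in> carrier M \<Longrightarrow> b \<in> carrier N \<Longrightarrow> P (a \<otimes>\<otimes> b)"
    and add: "\<And>t u. t \<in> carrier TT \<Longrightarrow> u \<in> carrier TT \<Longrightarrow> P t \<Longrightarrow> P u \<Longrightarrow> P (t \<oplus>\<^bsub>TT\<^esub> u)"
  shows "P t"
proof -
  obtain x where x: "t = cls x" "Poly_Mapping.keys x \<subseteq> carrier M \<times> carrier N"
    using t by (auto simp: tensor_carrier)
  have neg: "cls (- x) = \<ominus>\<^bsub>TT\<^esub> cls x" if "Poly_Mapping.keys x \<subseteq> carrier M \<times> carrier N" for x
  proof -
    have c: "x \<in> carrier PS" "- x \<in> carrier PS" using that by auto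
    have "cls (- x) \<oplus>\<^bsub>TT\<^esub> cls x = \<zero>\<^bsub>TT\<^esub>"
      unfolding tensor_add[OF c(2,1)] tensor_zero by simp
    then show ?thesis using c by (intro T.minus_equality[symmetric]) (auto simp: tensor_carrier)
  qed
  \<comment> \<open>\<open>frag_induction\<close> builds formal sums by differences, while
    \<open>P\<close> is only known to pass to sums; carrying \<open>P\<close> for the class of
    \<open>- x\<close> as well turns x - y into a sum.\<close>
  have "Poly_Mapping.keys x \<subseteq> carrier M \<times> carrier N \<and> P (cls x) \<and> P (cls (- x))"
    using x(2)
  proof (induction x rule: frag_induction)
    case zero
    have "P (\<zero>\<^bsub>M\<^esub> \<otimes>\<otimes> \<zero>\<^bsub>N\<^esub>)" by (rule pure) auto
    then show ?case by (simp add: pure_tensor_zero_left tensor_zero)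
  next
    case (one p)
    then obtain a b where p: "p = (a, b)" "a \<in> carrier M" "b \<in> carrier N" by auto
    have "cls (- frag_of p) = (\<ominus>\<^bsub>M\<^esub> a) \<otimes>\<otimes> b"
      using p neg[of "frag_of p"] by (simp add: pure_tensor_minus_left) (simp add: pure_tensor_def)
    then show ?case using p pure[of a b] pure[of "\<ominus>\<^bsub>M\<^esub> a" b] by (simp add: pure_tensor_def)
  next
    case (diff x y)
    have k: "Poly_Mapping.keys (- x) \<subseteq> carrier M \<times> carrier N" "Poly_Mapping.keys (- y) \<subseteq> carrier M \<times> carrier N"
      using diff by auto
    have "P (cls (x + - y))" "P (cls (y + - x))"
      using add[of "cls x" "cls (- y)"] add[of "cls y" "cls (- x)"] diff k
      by (auto simp: tensor_carrier tensor_add)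
    moreover have "Poly_Mapping.keys (x - y) \<subseteq> carrier M \<times> carrier N"
      using keys_add_subset[of x _ "- y"] diff k by simp
    ultimately show ?case by simp
  qed
  then show ?thesis using x(1) by blast
qed

text \<open>The universal property: \<open>f\<close> extends to the free abelian group on pairs, the
  relators lie in the kernel, and the extension factors through the quotient. The target is merely
  an abelian group; compatibility of the lifted map with scalars and products is checked afterwards
  on pure tensors.\<close>

lemma tensor_lift:
  fixes G (structure)
  assumes G: "abelian_group G"
    and f: "\<And>a b. a \<in> carrier M \<Longrightarrow> b \<in> carrier N \<Longrightarrow> f a b \<in> carrier G"
    and f_left: "\<And>a a' b. a \<in> carrier M \<Longrightarrow> a' \<in> carrier M \<Longrightarrow> b \<in> carrier N \<Longrightarrow>
      f (a \<oplus>\<^bsub>M\<^esub> a') b = f a b \<oplus> f a' b"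
    and f_right: "\<And>a b b'. a \<in> carrier M \<Longrightarrow> b \<in> carrier N \<Longrightarrow> b' \<in> carrier N \<Longrightarrow>
      f a (b \<oplus>\<^bsub>N\<^esub> b') = f a b \<oplus> f a b'"
    and f_balanced: "\<And>r a b. r \<in> carrier R \<Longrightarrow> a \<in> carrier M \<Longrightarrow> b \<in> carrier N \<Longrightarrow>
      f (r \<odot>\<^bsub>M\<^esub> a) b = f a (r \<odot>\<^bsub>N\<^esub> b)"
  obtains h where "\<And>t. t \<in> carrier TT \<Longrightarrow> h t \<in> carrier G"
    and "\<And>t u. t \<in> carrier TT \<Longrightarrow> u \<in> carrier TT \<Longrightarrow> h (t \<oplus>\<^bsub>TT\<^esub> u) = h t \<oplus> h u"
    and "\<And>a b. a \<in> carrier M \<Longrightarrow> b \<in> carrier N \<Longrightarrow> h (a \<otimes>\<otimes> b) = f a b"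
proof -
  interpret G: abelian_group G by fact
  have "(\<lambda>(a, b). f a b) ` (carrier M \<times> carrier N) \<subseteq> carrier (add_monoid G)" using f by auto
  then obtain h0 where h0: "h0 \<in> hom PS (add_monoid G)"
    and h0p: "\<And>p. p \<in> carrier M \<times> carrier N \<Longrightarrow> h0 (frag_of p) = (case p of (a, b) \<Rightarrow> f a b)"
    by (rule comm_group.free_Abelian_group_universal[OF G.a_comm_group]) blast
  have h0f: "h0 (frag_of (a, b)) = f a b" if "a \<in> carrier M" "b \<in> carrier N" for a b
    using h0p[of "(a, b)"] that by simp
  have h0c: "h0 x \<in> carrier G" if "x \<in> carrier PS" for x
    using hom_in_carrier[OF h0 that] by simp
  have h0a: "h0 (x + y) = h0 x \<oplus> h0 y" if "x \<in> carrier PS" "y \<in> carrier PS" for x y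
    using hom_mult[OF h0 that] by simp
  have h0d: "x - y \<in> carrier PS \<and> h0 (x - y) = h0 x \<ominus> h0 y"
    if xy: "x \<in> carrier PS" "y \<in> carrier PS" for x y
  proof -
    have c: "x - y \<in> carrier PS" using keys_add_subset[of x _ "- y"] xy by simp
    have "h0 x = h0 (x - y) \<oplus> h0 y" using h0a[OF c xy(2)] by simp
    then show ?thesis using c xy h0c by (simp add: G.minus_eq G.a_assoc G.r_neg)
  qed
  have fr: "frag_of (a, b) \<in> carrier PS" if "a \<in> carrier M" "b \<in> carrier N" for a b
    using that by simp
  interpret h: group_hom PS "add_monoid G" h0
    by (intro group_hom.intro group_hom_axioms.intro h0 group_free_Abelian_group G.a_group)
  \<comment> \<open>Relators come in two shapes: u - v - w from additivity in either factor, handled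
    here, and u - v from balancing, handled by \<open>two\<close>.\<close>
  have three: "u - v - w \<in> kernel PS (add_monoid G) h0"
    if "u \<in> carrier PS" "v \<in> carrier PS" "w \<in> carrier PS" "h0 u = h0 v \<oplus> h0 w" for u v w
  proof -
    have c: "u - v \<in> carrier PS" "u - v - w \<in> carrier PS" using h0d that by blast+
    have "h0 (u - v - w) = h0 u \<ominus> h0 v \<ominus> h0 w" using h0d that c by metis
    also have "\<dots> = \<zero>"
      using h0c[OF that(2)] h0c[OF that(3)]
      unfolding that(4) G.a_comm[OF h0c[OF that(2)] h0c[OF that(3)]]
      by (simp add: G.minus_eq G.a_assoc G.r_neg)
    finally show ?thesis using c(2) by (simp add: kernel_def del: carrier_free_Abelian_group_iff)
  qed
  have two: "u - v \<in> kernel PS (add_monoid G) h0"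
    if "u \<in> carrier PS" "v \<in> carrier PS" "h0 u = h0 v" for u v
    using h0d[OF that(1,2)] h0c[OF that(2)] that(3)
    by (simp add: kernel_def G.minus_eq G.r_neg del: carrier_free_Abelian_group_iff)
  have "x \<in> kernel PS (add_monoid G) h0" if "x \<in> tensor_relators R M N" for x
    using that unfolding tensor_relators_def
  proof (elim UnE CollectE exE conjE)
    fix a a' b assume *: "x = frag_of (a \<oplus>\<^bsub>M\<^esub> a', b) - frag_of (a, b) - frag_of (a', b)"
      "a \<in> carrier M" "a' \<in> carrier M" "b \<in> carrier N"
    then show ?thesis unfolding *(1) by (intro three) (simp_all add: h0f f_left)
  next
    fix a b b' assume *: "x = frag_of (a, b \<oplus>\<^bsub>N\<^esub> b') - frag_of (a, b) - frag_of (a, b')"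
      "a \<in> carrier M" "b \<in> carrier N" "b' \<in> carrier N"
    then show ?thesis unfolding *(1) by (intro three) (simp_all add: h0f f_right)
  next
    fix r a b assume *: "x = frag_of (r \<odot>\<^bsub>M\<^esub> a, b) - frag_of (a, r \<odot>\<^bsub>N\<^esub> b)"
      "r \<in> carrier R" "a \<in> carrier M" "b \<in> carrier N"
    then show ?thesis unfolding *(1) by (intro two) (simp_all add: h0f f_balanced)
  qed
  then have rel: "tensor_rel R M N \<subseteq> kernel PS (add_monoid G) h0"
    unfolding tensor_rel_def by (intro h.G.generate_subgroup_incl h.subgroup_kernel) blast
  have nrm: "tensor_rel R M N \<lhd> PS"
    by (rule comm_group.subgroup_imp_normal[OF abelian_free_Abelian_group tensor_rel_subgroup[OF M N]])
  from h.FactGroup_universal_kernel[OF nrm rel]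
  obtain h where h: "h \<in> hom (PS Mod tensor_rel R M N) (add_monoid G)"
    and hc: "\<And>x. x \<in> carrier PS \<Longrightarrow> h (cls x) = h0 x"
    unfolding tensor_class_def by blast
  show thesis
  proof (rule that[of h])
    show "h t \<in> carrier G" if "t \<in> carrier TT" for t
      using that h0c by (auto simp: tensor_carrier hc simp del: carrier_free_Abelian_group_iff)
    show "h (t \<oplus>\<^bsub>TT\<^esub> u) = h t \<oplus> h u" if "t \<in> carrier TT" "u \<in> carrier TT" for t u
      using hom_mult[OF h, of t u] that by (simp add: tensor_algebra_def)
    show "h (a \<otimes>\<otimes> b) = f a b" if "a \<in> carrier M" "b \<in> carrier N" for a b
      using hc[OF fr[OF that]] h0f that by (simp add: pure_tensor_def)
  qed
qed

text \<open>Both scalar actions in use, on the first factor and on the second, are instances of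
  \<open>tensor_action\<close>, so this serves \<open>tensor_algebra\<close> and
  \<open>base_change\<close> alike.\<close>

lemma tensor_action_closed_add:
  assumes r: "respects_tensor R M N f"
    and f: "\<And>p. p \<in> carrier M \<times> carrier N \<Longrightarrow> f p \<in> carrier M \<times> carrier N"
    and t: "t \<in> carrier TT" and u: "u \<in> carrier TT"
  shows "tensor_action R M N f t \<in> carrier TT"
    and "tensor_action R M N f (t \<oplus>\<^bsub>TT\<^esub> u) = tensor_action R M N f t \<oplus>\<^bsub>TT\<^esub> tensor_action R M N f u"
proof -
  let ?e = "frag_extend (\<lambda>p. frag_of (f p))"
  have e: "?e x \<in> carrier PS" if "x \<in> carrier PS" for x
    using that f unfolding carrier_free_Abelian_group_iff
    by (intro keys_frag_extend_subset) (auto simp del: mem_Times_iff)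
  obtain x y where xy: "t = cls x" "u = cls y" "x \<in> carrier PS" "y \<in> carrier PS"
    using t u by (auto simp: tensor_carrier)
  show "tensor_action R M N f t \<in> carrier TT"
    unfolding xy(1) tensor_action_class[OF M N r] tensor_carrier by (intro imageI e xy(3))
  show "tensor_action R M N f (t \<oplus>\<^bsub>TT\<^esub> u) = tensor_action R M N f t \<oplus>\<^bsub>TT\<^esub> tensor_action R M N f u"
    unfolding xy(1,2) tensor_add[OF xy(3,4)] tensor_action_class[OF M N r]
    unfolding tensor_add[OF e[OF xy(3)] e[OF xy(4)]] by (simp add: frag_extend_add)
qed

lemma tensor_smult_closed_add:
  assumes r: "r \<in> carrier R" and t: "t \<in> carrier TT" and u: "u \<in> carrier TT"
  shows "r \<odot>\<^bsub>TT\<^esub> t \<in> carrier TT"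
    and "r \<odot>\<^bsub>TT\<^esub> (t \<oplus>\<^bsub>TT\<^esub> u) = r \<odot>\<^bsub>TT\<^esub> t \<oplus>\<^bsub>TT\<^esub> r \<odot>\<^bsub>TT\<^esub> u"
proof -
  have "respects_tensor R M N (\<lambda>(a, b). (r \<odot>\<^bsub>M\<^esub> a, b))"
    by (rule respects_tensor_pair[OF M N])
      (use r in \<open>auto simp: M.smult_r_distr M.smult_assoc1[symmetric] M.R.m_comm\<close>)
  from tensor_action_closed_add[OF this _ t u] r
  show "r \<odot>\<^bsub>TT\<^esub> t \<in> carrier TT" "r \<odot>\<^bsub>TT\<^esub> (t \<oplus>\<^bsub>TT\<^esub> u) = r \<odot>\<^bsub>TT\<^esub> t \<oplus>\<^bsub>TT\<^esub> r \<odot>\<^bsub>TT\<^esub> u"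
    by (auto simp: tensor_algebra_def)
qed

end

lemma tensor_mult_closed_distrib:
  assumes M: "nonassoc_algebra R M" and N: "nonassoc_algebra R N"
  defines "T \<equiv> tensor_algebra R M N"
  assumes t: "t \<in> carrier T" and u: "u \<in> carrier T" and v: "v \<in> carrier T"
  shows "t \<otimes>\<^bsub>T\<^esub> u \<in> carrier T"
    and "(t \<oplus>\<^bsub>T\<^esub> u) \<otimes>\<^bsub>T\<^esub> v = t \<otimes>\<^bsub>T\<^esub> v \<oplus>\<^bsub>T\<^esub> u \<otimes>\<^bsub>T\<^esub> v"
    and "v \<otimes>\<^bsub>T\<^esub> (t \<oplus>\<^bsub>T\<^esub> u) = v \<otimes>\<^bsub>T\<^esub> t \<oplus>\<^bsub>T\<^esub> v \<otimes>\<^bsub>T\<^esub> u"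
proof -
  interpret M: nonassoc_algebra R M by fact
  interpret N: nonassoc_algebra R N by fact
  have m: "module R M" "module R N" by unfold_locales
  let ?c = "tensor_class R M N" and ?S = "carrier (pair_sums M N)"
  obtain x y z where x: "t = ?c x" "x \<in> ?S" and y: "u = ?c y" "y \<in> ?S" and z: "v = ?c z" "z \<in> ?S"
    using t u v unfolding T_def tensor_carrier[OF m] by blast
  have fm: "frag_mult M N x y \<in> ?S" if "x \<in> ?S" "y \<in> ?S" for x y
  proof -
    have "Poly_Mapping.keys (frag_extend (\<lambda>(a', b'). frag_of (a \<otimes>\<^bsub>M\<^esub> a', b \<otimes>\<^bsub>N\<^esub> b')) y)
        \<subseteq> carrier M \<times> carrier N" if ab: "a \<in> carrier M" "b \<in> carrier N" for a b
    proof (rule keys_frag_extend_subset)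
      fix p assume "p \<in> Poly_Mapping.keys y"
      then obtain a' b' where "p = (a', b')" "a' \<in> carrier M" "b' \<in> carrier N"
        using \<open>y \<in> ?S\<close> by auto
      then show "Poly_Mapping.keys (case p of (a', b') \<Rightarrow> frag_of (a \<otimes>\<^bsub>M\<^esub> a', b \<otimes>\<^bsub>N\<^esub> b'))
          \<subseteq> carrier M \<times> carrier N"
        using ab by (simp add: M.prod_closed N.prod_closed)
    qed
    then show ?thesis
      using \<open>x \<in> ?S\<close> unfolding carrier_free_Abelian_group_iff
      by (intro keys_frag_extend_subset) (auto simp: subset_iff)
  qed
  have mult: "?c x \<otimes>\<^bsub>T\<^esub> ?c y = ?c (frag_mult M N x y)" if "x \<in> ?S" "y \<in> ?S" for x y
    using tensor_mult_class[OF M N that] by (simp add: T_def tensor_algebra_def)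
  note add = tensor_add[OF m, folded T_def]
  have S: "x + y \<in> ?S" if "x \<in> ?S" "y \<in> ?S" for x y
    using that by (simp add: keys_add_subset)
  show "t \<otimes>\<^bsub>T\<^esub> u \<in> carrier T"
    unfolding x y mult[OF x(2) y(2)] unfolding T_def tensor_carrier[OF m] by (intro imageI fm x y)
  show "(t \<oplus>\<^bsub>T\<^esub> u) \<otimes>\<^bsub>T\<^esub> v = t \<otimes>\<^bsub>T\<^esub> v \<oplus>\<^bsub>T\<^esub> u \<otimes>\<^bsub>T\<^esub> v"
    unfolding x(1) y(1) z(1) add[OF x(2) y(2)] mult[OF S[OF x(2) y(2)] z(2)]
      mult[OF x(2) z(2)] mult[OF y(2) z(2)] add[OF fm[OF x(2) z(2)] fm[OF y(2) z(2)]] frag_extend_add ..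
  show "v \<otimes>\<^bsub>T\<^esub> (t \<oplus>\<^bsub>T\<^esub> u) = v \<otimes>\<^bsub>T\<^esub> t \<oplus>\<^bsub>T\<^esub> v \<otimes>\<^bsub>T\<^esub> u"
    unfolding x(1) y(1) z(1) add[OF x(2) y(2)] mult[OF z(2) S[OF x(2) y(2)]]
      mult[OF z(2) x(2)] mult[OF z(2) y(2)] add[OF fm[OF z(2) x(2)] fm[OF z(2) y(2)]] frag_mult_add_right ..
qed

section \<open>Base change of nonassociative algebras\<close>

lemma base_change_simps:
  "carrier (base_change R M B) = carrier (tensor_algebra R M B)"
  "monoid.mult (base_change R M B) = monoid.mult (tensor_algebra R M B)"
  "ring.add (base_change R M B) = ring.add (tensor_algebra R M B)"
  "ring.zero (base_change R M B) = ring.zero (tensor_algebra R M B)"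
  by (simp_all add: base_change_def with_smult_def)

lemma base_change_smult_closed_add:
  assumes M: "module R M" and B: "algebra R B" and s: "s \<in> carrier B"
    and t: "t \<in> carrier (base_change R M B)" and u: "u \<in> carrier (base_change R M B)"
  shows "s \<odot>\<^bsub>base_change R M B\<^esub> t \<in> carrier (base_change R M B)"
    and "s \<odot>\<^bsub>base_change R M B\<^esub> (t \<oplus>\<^bsub>base_change R M B\<^esub> u) =
      s \<odot>\<^bsub>base_change R M B\<^esub> t \<oplus>\<^bsub>base_change R M B\<^esub> s \<odot>\<^bsub>base_change R M B\<^esub> u"
proof -
  interpret B: nonassoc_algebra R B by (rule algebra_imp_nonassoc_algebra[OF B])
  have m: "module R B" by unfold_locales
  have "respects_tensor R M B (\<lambda>(a, b). (a, s \<otimes>\<^bsub>B\<^esub> b))"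
    by (rule respects_tensor_pair[OF M m])
      (use s in \<open>auto simp: B.prod_closed B.prod_add_right B.prod_smult_right\<close>)
  from tensor_action_closed_add[OF M m this _ t[unfolded base_change_simps] u[unfolded base_change_simps]] s
  show "s \<odot>\<^bsub>base_change R M B\<^esub> t \<in> carrier (base_change R M B)"
    "s \<odot>\<^bsub>base_change R M B\<^esub> (t \<oplus>\<^bsub>base_change R M B\<^esub> u) =
      s \<odot>\<^bsub>base_change R M B\<^esub> t \<oplus>\<^bsub>base_change R M B\<^esub> s \<odot>\<^bsub>base_change R M B\<^esub> u"
    by (auto simp: base_change_def with_smult_def B.prod_closed)
qed

text \<open>This setting is instantiated twice: with F, A and B, where properties are carried up
  from A to its base change, and with C, L and B regarded as a C-algebra, where they are brought
  down from the base change to L.\<close>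

locale algebra_base_change =
  fixes R :: "('r, 'k) ring_scheme" and A :: "('r, 'a, 'm) module_scheme"
    and B :: "('r, 'b, 'n) module_scheme"
  assumes A_algebra: "nonassoc_algebra R A" and B_algebra: "algebra R B"
begin

sublocale A: nonassoc_algebra R A by (rule A_algebra)
sublocale B: algebra R B by (rule B_algebra)

lemma B_nonassoc: "nonassoc_algebra R B"
  by (rule algebra_imp_nonassoc_algebra[OF B_algebra])

lemma A_module: "module R A" by unfold_locales
lemma B_module: "module R B" by unfold_locales

abbreviation "AB \<equiv> base_change R A B"
abbreviation pure (infixl "\<otimes>\<otimes>" 75) where "a \<otimes>\<otimes> b \<equiv> pure_tensor R A B a b"

lemmas AB_pure_closed = pure_tensor_closed[OF A_module B_module, folded base_change_simps(1)[of R A B]]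
lemmas AB_add_left = pure_tensor_add_left[OF A_module B_module, folded base_change_simps(3)[of R A B]]
lemmas AB_add_right = pure_tensor_add_right[OF A_module B_module, folded base_change_simps(3)[of R A B]]
lemmas AB_balanced = pure_tensor_balanced[OF A_module B_module]
lemmas AB_smult_pure = base_change_smult_pure[OF A_module B_algebra]
lemmas AB_mult_pure = tensor_algebra_mult_pure[OF A_algebra B_nonassoc, folded base_change_simps(2)[of R A B]]
lemmas AB_smult_closed = base_change_smult_closed_add(1)[OF A_module B_algebra]
lemmas AB_smult_add = base_change_smult_closed_add(2)[OF A_module B_algebra]
lemmas AB_mult = tensor_mult_closed_distrib[OF A_algebra B_nonassoc, folded base_change_simps(1-3)[of R A B]]
lemmas AB_induct = tensor_induct[OF A_module B_module, folded base_change_simps(1,3)[of R A B],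
  consumes 1, case_names pure add]
lemmas AB_lift = tensor_lift[OF A_module B_module, folded base_change_simps(1,3)[of R A B]]

lemma AB_abelian_group: "abelian_group AB"
proof -
  interpret T: abelian_group "tensor_algebra R A B" by (rule tensor_abelian_group[OF A_module B_module])
  show ?thesis
  proof (rule abelian_groupI, unfold base_change_simps)
    fix x assume "x \<in> carrier (tensor_algebra R A B)"
    then show "\<exists>y\<in>carrier (tensor_algebra R A B). y \<oplus>\<^bsub>tensor_algebra R A B\<^esub> x = \<zero>\<^bsub>tensor_algebra R A B\<^esub>"
      by (intro bexI[of _ "\<ominus>\<^bsub>tensor_algebra R A B\<^esub> x"]) (simp_all add: T.l_neg)
  qed (simp_all add: T.a_assoc, simp add: T.a_comm)
qed

text \<open>Each law is additive in its tensor arguments, so it is enough to test it on pure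
  tensors, where it becomes a law of \<open>A\<close> and \<open>B\<close>. Compatibility of scalars
  with the right factor moves a scalar past an element of \<open>B\<close> and uses that
  \<open>B\<close> is commutative.\<close>

sublocale AB: nonassoc_algebra B AB
proof (intro nonassoc_algebra.intro nonassoc_algebra_axioms.intro moduleI B.M_cring AB_abelian_group)
  interpret AB: abelian_group AB by (rule AB_abelian_group)
  show "s \<odot>\<^bsub>AB\<^esub> t \<in> carrier AB" if "s \<in> carrier B" "t \<in> carrier AB" for s t
    using AB_smult_closed that by blast
  show "s \<odot>\<^bsub>AB\<^esub> (t \<oplus>\<^bsub>AB\<^esub> u) = s \<odot>\<^bsub>AB\<^esub> t \<oplus>\<^bsub>AB\<^esub> s \<odot>\<^bsub>AB\<^esub> u"
    if "s \<in> carrier B" "t \<in> carrier AB" "u \<in> carrier AB" for s t u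
    using AB_smult_add that by blast
  show "(s \<oplus>\<^bsub>B\<^esub> s') \<odot>\<^bsub>AB\<^esub> t = s \<odot>\<^bsub>AB\<^esub> t \<oplus>\<^bsub>AB\<^esub> s' \<odot>\<^bsub>AB\<^esub> t"
    if s: "s \<in> carrier B" "s' \<in> carrier B" and t: "t \<in> carrier AB" for s s' t
    using t
  proof (induction t rule: AB_induct)
    case (pure a b)
    then show ?case using s by (simp add: AB_smult_pure B.l_distr AB_add_right)
  next
    case (add t u)
    then show ?case using s by (simp add: AB_smult_add AB_smult_closed AB.a_ac)
  qed
  show "(s \<otimes>\<^bsub>B\<^esub> s') \<odot>\<^bsub>AB\<^esub> t = s \<odot>\<^bsub>AB\<^esub> (s' \<odot>\<^bsub>AB\<^esub> t)"
    if s: "s \<in> carrier B" "s' \<in> carrier B" and t: "t \<in> carrier AB" for s s' t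
    using t
  proof (induction t rule: AB_induct)
    case (pure a b)
    then show ?case using s by (simp add: AB_smult_pure B.m_assoc)
  next
    case (add t u)
    then show ?case using s by (simp add: AB_smult_add AB_smult_closed)
  qed
  show "\<one>\<^bsub>B\<^esub> \<odot>\<^bsub>AB\<^esub> t = t" if t: "t \<in> carrier AB" for t
    using t
  proof (induction t rule: AB_induct)
    case (pure a b)
    then show ?case by (simp add: AB_smult_pure)
  next
    case (add t u)
    then show ?case by (simp add: AB_smult_add)
  qed
  show "t \<otimes>\<^bsub>AB\<^esub> u \<in> carrier AB" if "t \<in> carrier AB" "u \<in> carrier AB" for t u
    using AB_mult(1) that by blast
  show "(t \<oplus>\<^bsub>AB\<^esub> u) \<otimes>\<^bsub>AB\<^esub> v = t \<otimes>\<^bsub>AB\<^esub> v \<oplus>\<^bsub>AB\<^esub> u \<otimes>\<^bsub>AB\<^esub> v"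
    if "t \<in> carrier AB" "u \<in> carrier AB" "v \<in> carrier AB" for t u v
    by (rule AB_mult(2)[OF that])
  show "t \<otimes>\<^bsub>AB\<^esub> (u \<oplus>\<^bsub>AB\<^esub> v) = t \<otimes>\<^bsub>AB\<^esub> u \<oplus>\<^bsub>AB\<^esub> t \<otimes>\<^bsub>AB\<^esub> v"
    if "t \<in> carrier AB" "u \<in> carrier AB" "v \<in> carrier AB" for t u v
    by (rule AB_mult(3)[OF that(2,3,1)])
  show "(s \<odot>\<^bsub>AB\<^esub> t) \<otimes>\<^bsub>AB\<^esub> u = s \<odot>\<^bsub>AB\<^esub> (t \<otimes>\<^bsub>AB\<^esub> u)"
    if s: "s \<in> carrier B" and t: "t \<in> carrier AB" and u: "u \<in> carrier AB" for s t u
    using t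
  proof (induction t rule: AB_induct)
    case (pure a b)
    note ab = pure
    show ?case using u
    proof (induction u rule: AB_induct)
      case (pure c d)
      then show ?case using s ab by (simp add: AB_smult_pure AB_mult_pure A.prod_closed B.m_assoc)
    next
      case (add v w)
      then show ?case using s ab
        by (simp add: AB_mult AB_smult_add AB_smult_closed AB_pure_closed)
    qed
  next
    case (add v w)
    then show ?case using s u by (simp add: AB_mult AB_smult_add AB_smult_closed)
  qed
  show "t \<otimes>\<^bsub>AB\<^esub> (s \<odot>\<^bsub>AB\<^esub> u) = s \<odot>\<^bsub>AB\<^esub> (t \<otimes>\<^bsub>AB\<^esub> u)"
    if s: "s \<in> carrier B" and t: "t \<in> carrier AB" and u: "u \<in> carrier AB" for s t u
    using t
  proof (induction t rule: AB_induct)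
    case (pure a b)
    note ab = pure
    show ?case using u
    proof (induction u rule: AB_induct)
      case (pure c d)
      then show ?case using s ab by (simp add: AB_smult_pure AB_mult_pure A.prod_closed B.m_lcomm)
    next
      case (add v w)
      then show ?case using s ab
        by (simp add: AB_mult AB_smult_add AB_smult_closed AB_pure_closed)
    qed
  next
    case (add v w)
    then show ?case using s u by (simp add: AB_mult AB_smult_add AB_smult_closed)
  qed
qed

text \<open>The action of \<open>R\<close> is defined on the first factor and that of
  \<open>B\<close> on the second; balancing identifies \<open>r\<close> with the element
  \<open>r 1\<close> of \<open>B\<close>. This is the bridge between F-linearity and C-linearity on
  L.\<close>

lemma tensor_smult_eq:
  assumes r: "r \<in> carrier R" and t: "t \<in> carrier AB"
  shows "r \<odot>\<^bsub>tensor_algebra R A B\<^esub> t = (r \<odot>\<^bsub>B\<^esub> \<one>\<^bsub>B\<^esub>) \<odot>\<^bsub>AB\<^esub> t"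
  using t
proof (induction t rule: AB_induct)
  case (pure a b)
  have "(r \<odot>\<^bsub>B\<^esub> \<one>\<^bsub>B\<^esub>) \<otimes>\<^bsub>B\<^esub> b = r \<odot>\<^bsub>B\<^esub> b" using r pure by (simp add: B.smult_assoc2)
  then show ?case
    using r pure by (simp add: tensor_algebra_smult_pure[OF A_module B_module] AB_smult_pure AB_balanced)
next
  case (add t u)
  then show ?case
    using r tensor_smult_closed_add(2)[OF A_module B_module r, folded base_change_simps(1,3)[of R A B]]
    by (simp add: AB_smult_add)
qed

lemma pure_tensor_finsum:
  assumes "finite S" "f \<in> S \<rightarrow> carrier B" "a \<in> carrier A"
  shows "a \<otimes>\<otimes> (\<Oplus>\<^bsub>B\<^esub>x\<in>S. f x) = (\<Oplus>\<^bsub>AB\<^esub>x\<in>S. a \<otimes>\<otimes> f x)"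
  using assms
proof (induction S rule: finite_induct)
  case empty
  have "a \<otimes>\<otimes> \<zero>\<^bsub>B\<^esub> = \<zero>\<^bsub>B\<^esub> \<odot>\<^bsub>AB\<^esub> (a \<otimes>\<otimes> \<zero>\<^bsub>B\<^esub>)" using empty by (simp add: AB_smult_pure)
  also have "\<dots> = \<zero>\<^bsub>AB\<^esub>" using empty by (simp add: AB_pure_closed)
  finally show ?case by simp
next
  case (insert x S)
  then show ?case
    by (simp add: B.M.finsum_insert AB.M.finsum_insert AB_add_right AB_pure_closed Pi_iff)
qed

end

section \<open>Centroids\<close>

lemma CentI:
  assumes "\<chi> \<in> carrier A \<rightarrow>\<^sub>E carrier A"
    and "\<And>x y. x \<in> carrier A \<Longrightarrow> y \<in> carrier A \<Longrightarrow> \<chi> (x \<oplus>\<^bsub>A\<^esub> y) = \<chi> x \<oplus>\<^bsub>A\<^esub> \<chi> y"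
    and "\<And>r x. r \<in> carrier R \<Longrightarrow> x \<in> carrier A \<Longrightarrow> \<chi> (r \<odot>\<^bsub>A\<^esub> x) = r \<odot>\<^bsub>A\<^esub> \<chi> x"
    and "\<And>x y. x \<in> carrier A \<Longrightarrow> y \<in> carrier A \<Longrightarrow> \<chi> (x \<otimes>\<^bsub>A\<^esub> y) = x \<otimes>\<^bsub>A\<^esub> \<chi> y"
    and "\<And>x y. x \<in> carrier A \<Longrightarrow> y \<in> carrier A \<Longrightarrow> \<chi> (x \<otimes>\<^bsub>A\<^esub> y) = \<chi> x \<otimes>\<^bsub>A\<^esub> y"
  shows "\<chi> \<in> Cent R A"
  using assms by (simp add: Cent_def module_End_def)

lemma CentD:
  assumes "\<chi> \<in> Cent R A"
  shows "\<chi> \<in> extensional (carrier A)"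
    and "\<And>x. x \<in> carrier A \<Longrightarrow> \<chi> x \<in> carrier A"
    and "\<And>x y. x \<in> carrier A \<Longrightarrow> y \<in> carrier A \<Longrightarrow> \<chi> (x \<oplus>\<^bsub>A\<^esub> y) = \<chi> x \<oplus>\<^bsub>A\<^esub> \<chi> y"
    and "\<And>r x. r \<in> carrier R \<Longrightarrow> x \<in> carrier A \<Longrightarrow> \<chi> (r \<odot>\<^bsub>A\<^esub> x) = r \<odot>\<^bsub>A\<^esub> \<chi> x"
    and "\<And>x y. x \<in> carrier A \<Longrightarrow> y \<in> carrier A \<Longrightarrow> \<chi> (x \<otimes>\<^bsub>A\<^esub> y) = x \<otimes>\<^bsub>A\<^esub> \<chi> y"
    and "\<And>x y. x \<in> carrier A \<Longrightarrow> y \<in> carrier A \<Longrightarrow> \<chi> (x \<otimes>\<^bsub>A\<^esub> y) = \<chi> x \<otimes>\<^bsub>A\<^esub> y"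
  using assms unfolding Cent_def module_End_def PiE_iff mem_Collect_eq by blast+

lemma scalar_mapsI:
  assumes "r \<in> carrier R" "\<chi> \<in> extensional (carrier M)"
    and "\<And>x. x \<in> carrier M \<Longrightarrow> \<chi> x = r \<odot>\<^bsub>M\<^esub> x"
  shows "\<chi> \<in> scalar_maps R M"
proof -
  have "\<chi> = (\<lambda>x\<in>carrier M. r \<odot>\<^bsub>M\<^esub> x)" using assms by (intro extensionalityI[of _ "carrier M"]) auto
  then show ?thesis using assms(1) by (auto simp: scalar_maps_def)
qed

lemma (in nonassoc_algebra) scalar_maps_subset_Cent: "scalar_maps R A \<subseteq> Cent R A"
proof
  fix \<chi> assume "\<chi> \<in> scalar_maps R A"
  then obtain s where s: "s \<in> carrier R" and \<chi>: "\<chi> = (\<lambda>x\<in>carrier A. s \<odot>\<^bsub>A\<^esub> x)"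
    by (auto simp: scalar_maps_def)
  show "\<chi> \<in> Cent R A"
    unfolding \<chi> using s
    by (intro CentI)
      (auto simp: smult_r_distr smult_assoc1[symmetric] R.m_comm prod_closed prod_smult_left prod_smult_right)
qed

lemma (in nonassoc_algebra) central_algebraI:
  assumes "\<And>\<chi>. \<chi> \<in> Cent R A \<Longrightarrow> \<exists>r\<in>carrier R. \<forall>x\<in>carrier A. \<chi> x = r \<odot>\<^bsub>A\<^esub> x"
  shows "central_algebra R A"
proof -
  have "Cent R A \<subseteq> scalar_maps R A"
  proof
    fix \<chi> assume c: "\<chi> \<in> Cent R A"
    then obtain r where "r \<in> carrier R" "\<forall>x\<in>carrier A. \<chi> x = r \<odot>\<^bsub>A\<^esub> x" using assms by blast
    then show "\<chi> \<in> scalar_maps R A" using CentD(1)[OF c] by (intro scalar_mapsI) auto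
  qed
  then show ?thesis using scalar_maps_subset_Cent by (auto simp: central_algebra_def)
qed

lemma central_algebraD:
  assumes "central_algebra R A" "\<chi> \<in> Cent R A"
  obtains r where "r \<in> carrier R" "\<And>x. x \<in> carrier A \<Longrightarrow> \<chi> x = r \<odot>\<^bsub>A\<^esub> x"
  using assms by (auto simp: central_algebra_def scalar_maps_def)

lemma alg_isoD:
  assumes "\<phi> \<in> alg_iso R A A'"
  shows "bij_betw \<phi> (carrier A) (carrier A')"
    and "\<And>x y. x \<in> carrier A \<Longrightarrow> y \<in> carrier A \<Longrightarrow> \<phi> (x \<oplus>\<^bsub>A\<^esub> y) = \<phi> x \<oplus>\<^bsub>A'\<^esub> \<phi> y"
    and "\<And>x y. x \<in> carrier A \<Longrightarrow> y \<in> carrier A \<Longrightarrow> \<phi> (x \<otimes>\<^bsub>A\<^esub> y) = \<phi> x \<otimes>\<^bsub>A'\<^esub> \<phi> y"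
    and "\<And>r x. r \<in> carrier R \<Longrightarrow> x \<in> carrier A \<Longrightarrow> \<phi> (r \<odot>\<^bsub>A\<^esub> x) = r \<odot>\<^bsub>A'\<^esub> \<phi> x"
  using assms by (auto simp: alg_iso_def)

lemma alg_iso_inverse:
  assumes A: "nonassoc_algebra R A" and \<phi>: "\<phi> \<in> alg_iso R A A'"
  shows "inv_into (carrier A) \<phi> \<in> alg_iso R A' A"
proof -
  interpret nonassoc_algebra R A by fact
  note p = alg_isoD[OF \<phi>]
  let ?i = "inv_into (carrier A) \<phi>"
  have ic: "?i y \<in> carrier A" and pi: "\<phi> (?i y) = y" if "y \<in> carrier A'" for y
    using that p(1) by (auto simp: bij_betw_def inv_into_into f_inv_into_f)
  have ip: "?i (\<phi> x) = x" if "x \<in> carrier A" for x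
    using that p(1) by (simp add: bij_betw_def)
  have "?i (x \<oplus>\<^bsub>A'\<^esub> y) = ?i x \<oplus>\<^bsub>A\<^esub> ?i y" if "x \<in> carrier A'" "y \<in> carrier A'" for x y
    using ip[of "?i x \<oplus>\<^bsub>A\<^esub> ?i y"] that by (simp add: p ic pi)
  moreover have "?i (x \<otimes>\<^bsub>A'\<^esub> y) = ?i x \<otimes>\<^bsub>A\<^esub> ?i y" if "x \<in> carrier A'" "y \<in> carrier A'" for x y
    using ip[of "?i x \<otimes>\<^bsub>A\<^esub> ?i y"] that by (simp add: p ic pi prod_closed)
  moreover have "?i (r \<odot>\<^bsub>A'\<^esub> x) = r \<odot>\<^bsub>A\<^esub> ?i x" if "r \<in> carrier R" "x \<in> carrier A'" for r x
    using ip[of "r \<odot>\<^bsub>A\<^esub> ?i x"] that by (simp add: p ic pi)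
  ultimately show ?thesis
    using bij_betw_inv_into[OF p(1)] by (simp add: alg_iso_def)
qed

text \<open>Conjugation by \<open>\<phi>\<close> carries a centroid element of \<open>A\<close> to
  one of \<open>A'\<close>, and a scalar there pulls back to the same scalar because
  \<open>\<phi>\<close> is linear.\<close>

lemma central_algebra_alg_iso:
  assumes A: "nonassoc_algebra R A" and A': "nonassoc_algebra R A'"
    and \<phi>: "\<phi> \<in> alg_iso R A A'" and central: "central_algebra R A'"
  shows "central_algebra R A"
proof -
  interpret A: nonassoc_algebra R A by fact
  interpret A': nonassoc_algebra R A' by fact
  note p = alg_isoD[OF \<phi>]
  define \<psi> where "\<psi> = inv_into (carrier A) \<phi>"
  have "\<psi> \<in> alg_iso R A' A" unfolding \<psi>_def by (rule alg_iso_inverse[OF A \<phi>])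
  note q = alg_isoD[OF this]
  have pc: "\<phi> x \<in> carrier A'" and qp: "\<psi> (\<phi> x) = x" if "x \<in> carrier A" for x
    using that p(1) by (auto simp: \<psi>_def bij_betw_def)
  have qc: "\<psi> y \<in> carrier A" and pq: "\<phi> (\<psi> y) = y" if "y \<in> carrier A'" for y
    using that p(1) by (auto simp: \<psi>_def bij_betw_def inv_into_into f_inv_into_f)
  show ?thesis
  proof (rule A.central_algebraI)
    fix \<chi> assume "\<chi> \<in> Cent R A"
    note c = CentD[OF this]
    have "(\<lambda>y\<in>carrier A'. \<phi> (\<chi> (\<psi> y))) \<in> Cent R A'"
    proof (rule CentI)
      show "(\<lambda>y\<in>carrier A'. \<phi> (\<chi> (\<psi> y))) \<in> carrier A' \<rightarrow>\<^sub>E carrier A'"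
        by (auto simp: pc qc c)
    next
      fix x y assume "x \<in> carrier A'" "y \<in> carrier A'"
      then show "(\<lambda>y\<in>carrier A'. \<phi> (\<chi> (\<psi> y))) (x \<otimes>\<^bsub>A'\<^esub> y) = x \<otimes>\<^bsub>A'\<^esub> (\<lambda>y\<in>carrier A'. \<phi> (\<chi> (\<psi> y))) y"
        using c(5)[of "\<psi> x" "\<psi> y"] p(3)[of "\<psi> x" "\<chi> (\<psi> y)"]
        by (simp add: A'.prod_closed q qc pq c(2))
    next
      fix x y assume "x \<in> carrier A'" "y \<in> carrier A'"
      then show "(\<lambda>y\<in>carrier A'. \<phi> (\<chi> (\<psi> y))) (x \<otimes>\<^bsub>A'\<^esub> y) = (\<lambda>y\<in>carrier A'. \<phi> (\<chi> (\<psi> y))) x \<otimes>\<^bsub>A'\<^esub> y"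
        using c(6)[of "\<psi> x" "\<psi> y"] p(3)[of "\<chi> (\<psi> x)" "\<psi> y"]
        by (simp add: A'.prod_closed q qc pq c(2))
    qed (simp_all add: p q c pc qc)
    from central_algebraD[OF central this] obtain r where r: "r \<in> carrier R"
      and eq: "\<And>y. y \<in> carrier A' \<Longrightarrow> (\<lambda>y\<in>carrier A'. \<phi> (\<chi> (\<psi> y))) y = r \<odot>\<^bsub>A'\<^esub> y"
      by blast
    have "\<chi> x = r \<odot>\<^bsub>A\<^esub> x" if x: "x \<in> carrier A" for x
    proof -
      have "\<phi> (\<chi> x) = r \<odot>\<^bsub>A'\<^esub> \<phi> x" using eq[OF pc[OF x]] x by (simp add: pc qp)
      then have "\<psi> (\<phi> (\<chi> x)) = \<psi> (\<phi> (r \<odot>\<^bsub>A\<^esub> x))" using r x by (simp add: p)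
      then show ?thesis using r x by (simp add: qp c)
    qed
    then show "\<exists>r\<in>carrier R. \<forall>x\<in>carrier A. \<chi> x = r \<odot>\<^bsub>A\<^esub> x" using r by blast
  qed
qed

section \<open>Centrality: ascent to a base change and descent from it\<close>

context algebra_base_change
begin

text \<open>For a basis element \<open>x\<close> of \<open>B\<close> the map
  \<open>a \<otimes> b \<mapsto> k b x \<odot> a\<close> commutes with left and right multiplication
  by elements \<open>a \<otimes> 1\<close>. Composing it with \<open>\<psi>\<close> on
  \<open>A \<otimes> 1\<close> therefore gives a centroid element of \<open>A\<close>, that is a
  scalar \<open>l x\<close>, and \<open>b\<close> is assembled from these scalars as the sum of
  \<open>l x \<odot> x\<close>.\<close>

lemma central_base_change:
  assumes F: "field R" and central: "central_algebra R A"
  shows "central_algebra B AB"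
proof (rule AB.central_algebraI)
  fix \<psi> assume "\<psi> \<in> Cent B AB"
  note psi = CentD[OF this]
  obtain X where X: "module_basis R B X" by (rule vector_space_has_basis[OF F B_module])
  then have XB: "x \<in> carrier B" if "x \<in> X" for x using that by (auto simp: module_basis_def)
  obtain k where k: "\<And>m x. m \<in> carrier B \<Longrightarrow> x \<in> X \<Longrightarrow> k m x \<in> carrier R"
      "\<And>m n x. m \<in> carrier B \<Longrightarrow> n \<in> carrier B \<Longrightarrow> x \<in> X \<Longrightarrow> k (m \<oplus>\<^bsub>B\<^esub> n) x = k m x \<oplus>\<^bsub>R\<^esub> k n x"
      "\<And>r m x. r \<in> carrier R \<Longrightarrow> m \<in> carrier B \<Longrightarrow> x \<in> X \<Longrightarrow> k (r \<odot>\<^bsub>B\<^esub> m) x = r \<otimes>\<^bsub>R\<^esub> k m x"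
    and k_sum: "\<And>m. m \<in> carrier B \<Longrightarrow> \<exists>S. finite S \<and> S \<subseteq> X \<and> (\<forall>x\<in>X - S. k m x = \<zero>\<^bsub>R\<^esub>) \<and>
      m = (\<Oplus>\<^bsub>B\<^esub>x\<in>S. k m x \<odot>\<^bsub>B\<^esub> x)"
    by (rule B.basis_coordinates[OF X]) (rule that)
  \<comment> \<open>The properties of a lifted map are packed into one predicate so that a map can
    be chosen for all basis elements simultaneously.\<close>
  define coord where "coord x h \<longleftrightarrow> (\<forall>t\<in>carrier AB. h t \<in> carrier A) \<and>
      (\<forall>t\<in>carrier AB. \<forall>u\<in>carrier AB. h (t \<oplus>\<^bsub>AB\<^esub> u) = h t \<oplus>\<^bsub>A\<^esub> h u) \<and>
      (\<forall>a\<in>carrier A. \<forall>b\<in>carrier B. h (a \<otimes>\<otimes> b) = k b x \<odot>\<^bsub>A\<^esub> a)" for x h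
  have "\<exists>h. coord x h" if x: "x \<in> X" for x
  proof -
    obtain h where "\<And>t. t \<in> carrier AB \<Longrightarrow> h t \<in> carrier A"
      "\<And>t u. t \<in> carrier AB \<Longrightarrow> u \<in> carrier AB \<Longrightarrow> h (t \<oplus>\<^bsub>AB\<^esub> u) = h t \<oplus>\<^bsub>A\<^esub> h u"
      "\<And>a b. a \<in> carrier A \<Longrightarrow> b \<in> carrier B \<Longrightarrow> h (a \<otimes>\<otimes> b) = k b x \<odot>\<^bsub>A\<^esub> a"
      by (rule AB_lift[where f = "\<lambda>a b. k b x \<odot>\<^bsub>A\<^esub> a" and G = A, OF A.M.abelian_group_axioms])
        (use x in \<open>simp_all add: k A.smult_l_distr A.smult_r_distr A.smult_assoc1[symmetric] A.R.m_comm\<close>, blast)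
    then have "coord x h" unfolding coord_def by blast
    then show ?thesis by blast
  qed
  then have "\<forall>x\<in>X. \<exists>h. coord x h" by blast
  from bchoice[OF this] obtain h where "\<forall>x\<in>X. coord x (h x)" ..
  then have h: "\<And>x t. x \<in> X \<Longrightarrow> t \<in> carrier AB \<Longrightarrow> h x t \<in> carrier A"
      "\<And>x t u. x \<in> X \<Longrightarrow> t \<in> carrier AB \<Longrightarrow> u \<in> carrier AB \<Longrightarrow> h x (t \<oplus>\<^bsub>AB\<^esub> u) = h x t \<oplus>\<^bsub>A\<^esub> h x u"
      "\<And>x a b. x \<in> X \<Longrightarrow> a \<in> carrier A \<Longrightarrow> b \<in> carrier B \<Longrightarrow> h x (a \<otimes>\<otimes> b) = k b x \<odot>\<^bsub>A\<^esub> a"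
    unfolding coord_def by simp_all
  \<comment> \<open>The expansion is claimed over every finite index set containing the support, not
    over one set only; this makes the sum case go through and later allows expansion over a set
    enlarged by the support of \<open>l\<close>.\<close>
  have expand: "\<exists>S. finite S \<and> S \<subseteq> X \<and> (\<forall>x\<in>X - S. h x t = \<zero>\<^bsub>A\<^esub>) \<and>
      (\<forall>S'. finite S' \<longrightarrow> S \<subseteq> S' \<longrightarrow> S' \<subseteq> X \<longrightarrow> t = (\<Oplus>\<^bsub>AB\<^esub>x\<in>S'. h x t \<otimes>\<otimes> x))"
    if t: "t \<in> carrier AB" for t
    using t
  proof (induction t rule: AB_induct)
    case (pure a b)
    obtain S where S: "finite S" "S \<subseteq> X" "\<And>x. x \<in> X - S \<Longrightarrow> k b x = \<zero>\<^bsub>R\<^esub>"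
      and b: "b = (\<Oplus>\<^bsub>B\<^esub>x\<in>S. k b x \<odot>\<^bsub>B\<^esub> x)"
      using k_sum[OF pure(2)] by blast
    have "a \<otimes>\<otimes> b = (\<Oplus>\<^bsub>AB\<^esub>x\<in>S'. h x (a \<otimes>\<otimes> b) \<otimes>\<otimes> x)" if S': "finite S'" "S \<subseteq> S'" "S' \<subseteq> X" for S'
    proof -
      have kc: "(\<lambda>x. k b x \<odot>\<^bsub>B\<^esub> x) \<in> S' \<rightarrow> carrier B" using S' k(1) XB pure by auto
      have "b = (\<Oplus>\<^bsub>B\<^esub>x\<in>S'. k b x \<odot>\<^bsub>B\<^esub> x)"
        using S S' XB k(1) pure(2) by (subst b, intro B.finsum_smult_mono) auto
      then have "a \<otimes>\<otimes> b = (\<Oplus>\<^bsub>AB\<^esub>x\<in>S'. a \<otimes>\<otimes> (k b x \<odot>\<^bsub>B\<^esub> x))"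
        using pure_tensor_finsum[OF S'(1) kc pure(1)] by simp
      also have "\<dots> = (\<Oplus>\<^bsub>AB\<^esub>x\<in>S'. h x (a \<otimes>\<otimes> b) \<otimes>\<otimes> x)"
        using S' pure XB k(1) by (intro AB.M.finsum_cong') (auto simp: h AB_balanced AB_pure_closed subset_iff)
      finally show ?thesis .
    qed
    then show ?case using S pure by (intro exI[of _ S]) (auto simp: h)
  next
    case (add t u)
    obtain S where S: "finite S" "S \<subseteq> X" "\<And>x. x \<in> X - S \<Longrightarrow> h x t = \<zero>\<^bsub>A\<^esub>"
      "\<And>S'. finite S' \<Longrightarrow> S \<subseteq> S' \<Longrightarrow> S' \<subseteq> X \<Longrightarrow> t = (\<Oplus>\<^bsub>AB\<^esub>x\<in>S'. h x t \<otimes>\<otimes> x)"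
      using add.IH(1) by blast
    obtain U where U: "finite U" "U \<subseteq> X" "\<And>x. x \<in> X - U \<Longrightarrow> h x u = \<zero>\<^bsub>A\<^esub>"
      "\<And>S'. finite S' \<Longrightarrow> U \<subseteq> S' \<Longrightarrow> S' \<subseteq> X \<Longrightarrow> u = (\<Oplus>\<^bsub>AB\<^esub>x\<in>S'. h x u \<otimes>\<otimes> x)"
      using add.IH(2) by blast
    have "t \<oplus>\<^bsub>AB\<^esub> u = (\<Oplus>\<^bsub>AB\<^esub>x\<in>S'. h x (t \<oplus>\<^bsub>AB\<^esub> u) \<otimes>\<otimes> x)"
      if S': "finite S'" "S \<union> U \<subseteq> S'" "S' \<subseteq> X" for S'
    proof -
      have hc: "h x v \<otimes>\<otimes> x \<in> carrier AB" if "x \<in> S'" "v \<in> carrier AB" for x v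
        using that S' XB by (auto intro!: AB_pure_closed h)
      have "(\<Oplus>\<^bsub>AB\<^esub>x\<in>S'. h x (t \<oplus>\<^bsub>AB\<^esub> u) \<otimes>\<otimes> x) = (\<Oplus>\<^bsub>AB\<^esub>x\<in>S'. h x t \<otimes>\<otimes> x \<oplus>\<^bsub>AB\<^esub> h x u \<otimes>\<otimes> x)"
        using add.hyps S' XB by (intro AB.M.finsum_cong') (auto simp: h AB_add_left subset_iff AB_pure_closed)
      also have "\<dots> = (\<Oplus>\<^bsub>AB\<^esub>x\<in>S'. h x t \<otimes>\<otimes> x) \<oplus>\<^bsub>AB\<^esub> (\<Oplus>\<^bsub>AB\<^esub>x\<in>S'. h x u \<otimes>\<otimes> x)"
        using add.hyps hc by (intro AB.M.finsum_addf) auto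
      also have "\<dots> = t \<oplus>\<^bsub>AB\<^esub> u" using S(4)[of S'] U(4)[of S'] S' by simp
      finally show ?thesis by simp
    qed
    then show ?case
      using S(1-3) U(1-3) add.hyps by (intro exI[of _ "S \<union> U"]) (auto simp: h)
  qed
  have psi_one: "a \<otimes>\<otimes> \<one>\<^bsub>B\<^esub> \<in> carrier AB" "\<psi> (a \<otimes>\<otimes> \<one>\<^bsub>B\<^esub>) \<in> carrier AB" if "a \<in> carrier A" for a
    using that by (auto intro!: psi(2) AB_pure_closed)
  have "\<exists>r\<in>carrier R. \<forall>a\<in>carrier A. h x (\<psi> (a \<otimes>\<otimes> \<one>\<^bsub>B\<^esub>)) = r \<odot>\<^bsub>A\<^esub> a" if x: "x \<in> X" for x
  proof -
    \<comment> \<open>The base change carries only \<open>B\<close>-scalars, so \<open>r\<close> has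
      to act through the element \<open>r 1\<close> of \<open>B\<close>.\<close>
    have hs: "h x ((r \<odot>\<^bsub>B\<^esub> \<one>\<^bsub>B\<^esub>) \<odot>\<^bsub>AB\<^esub> t) = r \<odot>\<^bsub>A\<^esub> h x t" if r: "r \<in> carrier R" and t: "t \<in> carrier AB" for r t
      using t
    proof (induction t rule: AB_induct)
      case (pure a b)
      then show ?case using r x
        by (simp add: AB_smult_pure h B.smult_assoc2 k A.smult_assoc1)
    next
      case (add t u)
      then show ?case using r x by (simp add: AB_smult_add AB_smult_closed h A.smult_r_distr)
    qed
    have hl: "h x ((a \<otimes>\<otimes> \<one>\<^bsub>B\<^esub>) \<otimes>\<^bsub>AB\<^esub> t) = a \<otimes>\<^bsub>A\<^esub> h x t" if a: "a \<in> carrier A" and t: "t \<in> carrier AB" for a t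
      using t
    proof (induction t rule: AB_induct)
      case (pure c b)
      then show ?case using a x by (simp add: AB_mult_pure h k A.prod_closed A.prod_smult_right)
    next
      case (add t u)
      then show ?case using a x by (simp add: AB_mult psi_one h A.prod_add_right)
    qed
    have hr: "h x (t \<otimes>\<^bsub>AB\<^esub> (a \<otimes>\<otimes> \<one>\<^bsub>B\<^esub>)) = h x t \<otimes>\<^bsub>A\<^esub> a" if a: "a \<in> carrier A" and t: "t \<in> carrier AB" for a t
      using t
    proof (induction t rule: AB_induct)
      case (pure c b)
      then show ?case using a x by (simp add: AB_mult_pure h k A.prod_closed A.prod_smult_left)
    next
      case (add t u)
      then show ?case using a x by (simp add: AB_mult psi_one h A.prod_add_left)
    qed
    have "(\<lambda>a\<in>carrier A. h x (\<psi> (a \<otimes>\<otimes> \<one>\<^bsub>B\<^esub>))) \<in> Cent R A"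
    proof (rule CentI)
      show "(\<lambda>a\<in>carrier A. h x (\<psi> (a \<otimes>\<otimes> \<one>\<^bsub>B\<^esub>))) \<in> carrier A \<rightarrow>\<^sub>E carrier A"
        using x by (auto simp: h psi_one)
    next
      fix a c assume "a \<in> carrier A" "c \<in> carrier A"
      then show "(\<lambda>a\<in>carrier A. h x (\<psi> (a \<otimes>\<otimes> \<one>\<^bsub>B\<^esub>))) (a \<oplus>\<^bsub>A\<^esub> c) =
          (\<lambda>a\<in>carrier A. h x (\<psi> (a \<otimes>\<otimes> \<one>\<^bsub>B\<^esub>))) a \<oplus>\<^bsub>A\<^esub> (\<lambda>a\<in>carrier A. h x (\<psi> (a \<otimes>\<otimes> \<one>\<^bsub>B\<^esub>))) c"
        using x by (simp add: AB_add_left psi psi_one h)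
    next
      fix r a assume ra: "r \<in> carrier R" "a \<in> carrier A"
      then have "(r \<odot>\<^bsub>A\<^esub> a) \<otimes>\<otimes> \<one>\<^bsub>B\<^esub> = (r \<odot>\<^bsub>B\<^esub> \<one>\<^bsub>B\<^esub>) \<odot>\<^bsub>AB\<^esub> (a \<otimes>\<otimes> \<one>\<^bsub>B\<^esub>)"
        by (simp add: AB_balanced AB_smult_pure)
      then show "(\<lambda>a\<in>carrier A. h x (\<psi> (a \<otimes>\<otimes> \<one>\<^bsub>B\<^esub>))) (r \<odot>\<^bsub>A\<^esub> a) = r \<odot>\<^bsub>A\<^esub> (\<lambda>a\<in>carrier A. h x (\<psi> (a \<otimes>\<otimes> \<one>\<^bsub>B\<^esub>))) a"
        using x ra by (simp add: psi psi_one hs)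
    next
      fix a c assume ac: "a \<in> carrier A" "c \<in> carrier A"
      then have m: "(a \<otimes>\<^bsub>A\<^esub> c) \<otimes>\<otimes> \<one>\<^bsub>B\<^esub> = (a \<otimes>\<otimes> \<one>\<^bsub>B\<^esub>) \<otimes>\<^bsub>AB\<^esub> (c \<otimes>\<otimes> \<one>\<^bsub>B\<^esub>)"
        by (simp add: AB_mult_pure)
      show "(\<lambda>a\<in>carrier A. h x (\<psi> (a \<otimes>\<otimes> \<one>\<^bsub>B\<^esub>))) (a \<otimes>\<^bsub>A\<^esub> c) = a \<otimes>\<^bsub>A\<^esub> (\<lambda>a\<in>carrier A. h x (\<psi> (a \<otimes>\<otimes> \<one>\<^bsub>B\<^esub>))) c"
        using ac by (simp add: A.prod_closed m psi(5) psi_one hl)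
      show "(\<lambda>a\<in>carrier A. h x (\<psi> (a \<otimes>\<otimes> \<one>\<^bsub>B\<^esub>))) (a \<otimes>\<^bsub>A\<^esub> c) = (\<lambda>a\<in>carrier A. h x (\<psi> (a \<otimes>\<otimes> \<one>\<^bsub>B\<^esub>))) a \<otimes>\<^bsub>A\<^esub> c"
        using ac by (simp add: A.prod_closed m psi(6) psi_one hr)
    qed
    from central_algebraD[OF central this] obtain r where r: "r \<in> carrier R"
      "\<And>a. a \<in> carrier A \<Longrightarrow> (\<lambda>a\<in>carrier A. h x (\<psi> (a \<otimes>\<otimes> \<one>\<^bsub>B\<^esub>))) a = r \<odot>\<^bsub>A\<^esub> a"
      by blast
    show ?thesis using r(2) by (intro bexI[OF _ r(1)]) simp
  qed
  then have "\<forall>x\<in>X. \<exists>r. r \<in> carrier R \<and> (\<forall>a\<in>carrier A. h x (\<psi> (a \<otimes>\<otimes> \<one>\<^bsub>B\<^esub>)) = r \<odot>\<^bsub>A\<^esub> a)" by blast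
  from bchoice[OF this] obtain l where
    "\<forall>x\<in>X. l x \<in> carrier R \<and> (\<forall>a\<in>carrier A. h x (\<psi> (a \<otimes>\<otimes> \<one>\<^bsub>B\<^esub>)) = l x \<odot>\<^bsub>A\<^esub> a)" ..
  then have l: "\<And>x. x \<in> X \<Longrightarrow> l x \<in> carrier R"
    "\<And>x a. x \<in> X \<Longrightarrow> a \<in> carrier A \<Longrightarrow> h x (\<psi> (a \<otimes>\<otimes> \<one>\<^bsub>B\<^esub>)) = l x \<odot>\<^bsub>A\<^esub> a"
    by simp_all
  \<comment> \<open>One nonzero \<open>a\<close> shows that almost all of the scalars \<open>l x\<close> vanish.\<close>
  have "\<exists>b\<in>carrier B. \<forall>a\<in>carrier A. \<psi> (a \<otimes>\<otimes> \<one>\<^bsub>B\<^esub>) = a \<otimes>\<otimes> b"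
  \<comment> \<open>In the zero algebra any \<open>b\<close> serves, and there is no nonzero
    \<open>a\<close> with which to bound the support of \<open>l\<close>.\<close>
  proof (cases "carrier A = {\<zero>\<^bsub>A\<^esub>}")
    case True
    have "\<psi> (\<zero>\<^bsub>A\<^esub> \<otimes>\<otimes> \<one>\<^bsub>B\<^esub>) = \<zero>\<^bsub>A\<^esub> \<otimes>\<otimes> \<one>\<^bsub>B\<^esub>"
    proof -
      have z: "\<zero>\<^bsub>A\<^esub> \<otimes>\<otimes> \<one>\<^bsub>B\<^esub> = \<zero>\<^bsub>AB\<^esub>"
        using pure_tensor_zero_left[OF A_module B_module] by (simp add: base_change_simps)
      have "\<psi> (\<zero>\<^bsub>B\<^esub> \<odot>\<^bsub>AB\<^esub> \<zero>\<^bsub>AB\<^esub>) = \<zero>\<^bsub>B\<^esub> \<odot>\<^bsub>AB\<^esub> \<psi> \<zero>\<^bsub>AB\<^esub>" by (rule psi(4)) auto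
      then show ?thesis unfolding z by (simp add: psi(2))
    qed
    then show ?thesis using True by (intro bexI[of _ "\<one>\<^bsub>B\<^esub>"]) auto
  next
    case False
    then obtain a where a: "a \<in> carrier A" "a \<noteq> \<zero>\<^bsub>A\<^esub>" using A.M.zero_closed by blast
    obtain S where S: "finite S" "S \<subseteq> X" and Sz: "\<And>x. x \<in> X - S \<Longrightarrow> h x (\<psi> (a \<otimes>\<otimes> \<one>\<^bsub>B\<^esub>)) = \<zero>\<^bsub>A\<^esub>"
      using expand[OF psi_one(2)[OF a(1)]] by blast
    have lz: "l x = \<zero>\<^bsub>R\<^esub>" if x: "x \<in> X - S" for x
    proof (rule ccontr)
      interpret R: field R by fact
      assume nz: "l x \<noteq> \<zero>\<^bsub>R\<^esub>"
      then have i: "inv\<^bsub>R\<^esub> (l x) \<in> carrier R" "inv\<^bsub>R\<^esub> (l x) \<otimes>\<^bsub>R\<^esub> l x = \<one>\<^bsub>R\<^esub>"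
        using l(1)[of x] x by (auto simp: R.field_Units)
      have "a = inv\<^bsub>R\<^esub> (l x) \<odot>\<^bsub>A\<^esub> (l x \<odot>\<^bsub>A\<^esub> a)"
        using i l(1)[of x] x a by (simp add: A.smult_assoc1[symmetric])
      also have "l x \<odot>\<^bsub>A\<^esub> a = \<zero>\<^bsub>A\<^esub>" using Sz[OF x] l(2)[of x a] x a by simp
      finally show False using a i by simp
    qed
    define b where "b = (\<Oplus>\<^bsub>B\<^esub>x\<in>S. l x \<odot>\<^bsub>B\<^esub> x)"
    have "b \<in> carrier B" unfolding b_def using S l(1) XB by (intro B.M.finsum_closed) auto
    moreover have "\<psi> (c \<otimes>\<otimes> \<one>\<^bsub>B\<^esub>) = c \<otimes>\<otimes> b" if c: "c \<in> carrier A" for c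
    proof -
      obtain U where U: "finite U" "U \<subseteq> X" and
        Us: "\<And>S'. finite S' \<Longrightarrow> U \<subseteq> S' \<Longrightarrow> S' \<subseteq> X \<Longrightarrow>
          \<psi> (c \<otimes>\<otimes> \<one>\<^bsub>B\<^esub>) = (\<Oplus>\<^bsub>AB\<^esub>x\<in>S'. h x (\<psi> (c \<otimes>\<otimes> \<one>\<^bsub>B\<^esub>)) \<otimes>\<otimes> x)"
        using expand[OF psi_one(2)[OF c]] by blast
      \<comment> \<open>\<open>S\<close> comes from the fixed nonzero \<open>a\<close> and contains
        the support of \<open>l\<close>; \<open>U\<close> supports the expansion of
        \<open>\<psi> (c \<otimes> 1)\<close>. Over the union the expansion is valid, and the sum
        defining \<open>b\<close> is unchanged because \<open>l\<close> vanishes off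
        \<open>S\<close>.\<close>
      let ?S' = "S \<union> U"
      have "\<psi> (c \<otimes>\<otimes> \<one>\<^bsub>B\<^esub>) = (\<Oplus>\<^bsub>AB\<^esub>x\<in>?S'. h x (\<psi> (c \<otimes>\<otimes> \<one>\<^bsub>B\<^esub>)) \<otimes>\<otimes> x)"
        using S U by (intro Us) auto
      also have "\<dots> = (\<Oplus>\<^bsub>AB\<^esub>x\<in>?S'. c \<otimes>\<otimes> (l x \<odot>\<^bsub>B\<^esub> x))"
        using S U c XB l(1) by (intro AB.M.finsum_cong') (auto simp: l(2) AB_balanced AB_pure_closed subset_iff)
      also have "\<dots> = c \<otimes>\<otimes> (\<Oplus>\<^bsub>B\<^esub>x\<in>?S'. l x \<odot>\<^bsub>B\<^esub> x)"
        using S U c XB l(1) by (intro pure_tensor_finsum[symmetric]) auto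
      also have "(\<Oplus>\<^bsub>B\<^esub>x\<in>?S'. l x \<odot>\<^bsub>B\<^esub> x) = b"
        unfolding b_def using S U XB l(1) lz by (intro B.finsum_smult_mono[symmetric]) auto
      finally show ?thesis .
    qed
    ultimately show ?thesis by blast
  qed
  then obtain b where b: "b \<in> carrier B" "\<And>a. a \<in> carrier A \<Longrightarrow> \<psi> (a \<otimes>\<otimes> \<one>\<^bsub>B\<^esub>) = a \<otimes>\<otimes> b" by blast
  have "\<psi> t = b \<odot>\<^bsub>AB\<^esub> t" if "t \<in> carrier AB" for t
    using that
  proof (induction t rule: AB_induct)
    \<comment> \<open>\<open>a \<otimes> c\<close> is \<open>c\<close> times
      \<open>a \<otimes> 1\<close>, so \<open>B\<close>-linearity determines \<open>\<psi>\<close>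
      from its values on \<open>A \<otimes> 1\<close>.\<close>
    case (pure a c)
    have "\<psi> (a \<otimes>\<otimes> c) = \<psi> (c \<odot>\<^bsub>AB\<^esub> (a \<otimes>\<otimes> \<one>\<^bsub>B\<^esub>))" using pure by (simp add: AB_smult_pure)
    also have "\<dots> = c \<odot>\<^bsub>AB\<^esub> (a \<otimes>\<otimes> b)" using pure by (simp add: psi(4) psi_one b)
    also have "\<dots> = b \<odot>\<^bsub>AB\<^esub> (a \<otimes>\<otimes> c)" using pure b by (simp add: AB_smult_pure B.m_comm)
    finally show ?case .
  next
    case (add t u)
    then show ?case using b by (simp add: psi(3) AB_smult_add)
  qed
  then show "\<exists>b\<in>carrier B. \<forall>t\<in>carrier AB. \<psi> t = b \<odot>\<^bsub>AB\<^esub> t" using b(1) by blast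
qed

text \<open>The assumptions on \<open>p\<close> make it an \<open>R\<close>-linear retraction of
  \<open>B\<close> onto the scalars, so that the lift of \<open>p b \<odot> a\<close> recovers
  \<open>x\<close> from \<open>x \<otimes> 1\<close>. The scalar found for \<open>\<chi>\<close> is
  then the image under \<open>p\<close> of the element of \<open>B\<close> by which its extension
  acts.\<close>

lemma central_descent:
  assumes p: "\<And>b. b \<in> carrier B \<Longrightarrow> p b \<in> carrier R"
      "\<And>b c. b \<in> carrier B \<Longrightarrow> c \<in> carrier B \<Longrightarrow> p (b \<oplus>\<^bsub>B\<^esub> c) = p b \<oplus>\<^bsub>R\<^esub> p c"
      "\<And>r b. r \<in> carrier R \<Longrightarrow> b \<in> carrier B \<Longrightarrow> p (r \<odot>\<^bsub>B\<^esub> b) = r \<otimes>\<^bsub>R\<^esub> p b"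
      "p \<one>\<^bsub>B\<^esub> = \<one>\<^bsub>R\<^esub>"
    and central: "central_algebra B AB"
  shows "central_algebra R A"
proof (rule A.central_algebraI)
  fix \<chi> assume "\<chi> \<in> Cent R A"
  note c = CentD[OF this]
  obtain \<pi> where pi: "\<And>a b. a \<in> carrier A \<Longrightarrow> b \<in> carrier B \<Longrightarrow> \<pi> (a \<otimes>\<otimes> b) = p b \<odot>\<^bsub>A\<^esub> a"
    by (rule AB_lift[where f = "\<lambda>a b. p b \<odot>\<^bsub>A\<^esub> a" and G = A, OF A.M.abelian_group_axioms])
      (simp_all add: p A.smult_l_distr A.smult_r_distr A.smult_assoc1[symmetric] A.R.m_comm, blast)
  \<comment> \<open>This is \<open>\<chi>\<close> tensored with the identity;
    \<open>R\<close>-linearity of \<open>\<chi>\<close> is what makes the defining map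
    balanced.\<close>
  obtain \<xi> where xi: "\<And>t. t \<in> carrier AB \<Longrightarrow> \<xi> t \<in> carrier AB"
      "\<And>t u. t \<in> carrier AB \<Longrightarrow> u \<in> carrier AB \<Longrightarrow> \<xi> (t \<oplus>\<^bsub>AB\<^esub> u) = \<xi> t \<oplus>\<^bsub>AB\<^esub> \<xi> u"
      "\<And>a b. a \<in> carrier A \<Longrightarrow> b \<in> carrier B \<Longrightarrow> \<xi> (a \<otimes>\<otimes> b) = \<chi> a \<otimes>\<otimes> b"
    by (rule AB_lift[where f = "\<lambda>a b. \<chi> a \<otimes>\<otimes> b" and G = AB, OF AB_abelian_group])
      (simp_all add: AB_pure_closed c(2-4) AB_add_left AB_add_right AB_balanced, blast)
  have mult_right: "\<xi> (t \<otimes>\<^bsub>AB\<^esub> u) = t \<otimes>\<^bsub>AB\<^esub> \<xi> u"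
    if t: "t \<in> carrier AB" and u: "u \<in> carrier AB" for t u
    using t
  proof (induction t rule: AB_induct)
    case (pure a b)
    note ab = pure
    show ?case using u
    proof (induction u rule: AB_induct)
      case (pure a' b')
      then show ?case using ab c(5)[of a a'] by (simp add: AB_mult_pure xi A.prod_closed c(2))
    next
      case (add v w)
      then show ?case using ab by (simp add: AB_mult xi(1,2) AB_pure_closed)
    qed
  next
    case (add v w)
    then show ?case using u by (simp add: AB_mult xi)
  qed
  have mult_left: "\<xi> (t \<otimes>\<^bsub>AB\<^esub> u) = \<xi> t \<otimes>\<^bsub>AB\<^esub> u"
    if t: "t \<in> carrier AB" and u: "u \<in> carrier AB" for t u
    using t
  proof (induction t rule: AB_induct)
    case (pure a b)
    note ab = pure
    show ?case using u
    proof (induction u rule: AB_induct)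
      case (pure a' b')
      then show ?case using ab c(6)[of a a'] by (simp add: AB_mult_pure xi A.prod_closed c(2))
    next
      case (add v w)
      then show ?case using ab by (simp add: AB_mult xi(1,2) AB_pure_closed)
    qed
  next
    case (add v w)
    then show ?case using u by (simp add: AB_mult xi)
  qed
  have smult: "\<xi> (s \<odot>\<^bsub>AB\<^esub> t) = s \<odot>\<^bsub>AB\<^esub> \<xi> t" if s: "s \<in> carrier B" and t: "t \<in> carrier AB" for s t
    using t
  proof (induction t rule: AB_induct)
    case (pure a b)
    then show ?case using s by (simp add: AB_smult_pure xi c)
  next
    case (add t u)
    then show ?case using s by (simp add: AB_smult_add AB_smult_closed xi)
  qed
  have "restrict \<xi> (carrier AB) \<in> Cent B AB"
    by (rule CentI) (simp_all add: xi(1,2) smult AB.prod_closed mult_right mult_left[symmetric])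
  from central_algebraD[OF central this] obtain s where s: "s \<in> carrier B"
    and eq: "\<And>t. t \<in> carrier AB \<Longrightarrow> restrict \<xi> (carrier AB) t = s \<odot>\<^bsub>AB\<^esub> t"
    by blast
  have "\<chi> x = p s \<odot>\<^bsub>A\<^esub> x" if x: "x \<in> carrier A" for x
  proof -
    have "\<chi> x \<otimes>\<otimes> \<one>\<^bsub>B\<^esub> = x \<otimes>\<otimes> s"
      using eq[of "x \<otimes>\<otimes> \<one>\<^bsub>B\<^esub>"] x s by (simp add: AB_pure_closed xi AB_smult_pure)
    then have "\<pi> (\<chi> x \<otimes>\<otimes> \<one>\<^bsub>B\<^esub>) = \<pi> (x \<otimes>\<otimes> s)" by simp
    then show ?thesis using x s by (simp add: pi c p)
  qed
  then show "\<exists>r\<in>carrier R. \<forall>x\<in>carrier A. \<chi> x = r \<odot>\<^bsub>A\<^esub> x" using p(1) s by blast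
qed

end

section \<open>Perfect algebras\<close>

text \<open>Perfectness without reference to scalars, as a principle of induction.\<close>

definition product_generated :: "('a, 'm) ring_scheme \<Rightarrow> bool" where
  "product_generated A \<longleftrightarrow> (\<forall>P.
    (\<forall>x\<in>carrier A. \<forall>y\<in>carrier A. P (x \<otimes>\<^bsub>A\<^esub> y)) \<longrightarrow>
    (\<forall>x\<in>carrier A. \<forall>y\<in>carrier A. P x \<longrightarrow> P y \<longrightarrow> P (x \<oplus>\<^bsub>A\<^esub> y)) \<longrightarrow>
    (\<forall>x\<in>carrier A. P x))"

lemma product_generatedI:
  assumes "\<And>P x. (\<And>x y. x \<in> carrier A \<Longrightarrow> y \<in> carrier A \<Longrightarrow> P (x \<otimes>\<^bsub>A\<^esub> y)) \<Longrightarrow>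
    (\<And>x y. x \<in> carrier A \<Longrightarrow> y \<in> carrier A \<Longrightarrow> P x \<Longrightarrow> P y \<Longrightarrow> P (x \<oplus>\<^bsub>A\<^esub> y)) \<Longrightarrow>
    x \<in> carrier A \<Longrightarrow> P x"
  shows "product_generated A"
  unfolding product_generated_def
proof (intro allI impI ballI)
  fix P x
  assume "\<forall>x\<in>carrier A. \<forall>y\<in>carrier A. P (x \<otimes>\<^bsub>A\<^esub> y)"
    "\<forall>x\<in>carrier A. \<forall>y\<in>carrier A. P x \<longrightarrow> P y \<longrightarrow> P (x \<oplus>\<^bsub>A\<^esub> y)" "x \<in> carrier A"
  then show "P x" using assms[of P x] by simp
qed

lemma product_generated_induct [consumes 2, case_names mult add]:
  assumes "product_generated A" "x \<in> carrier A"
    and "\<And>x y. x \<in> carrier A \<Longrightarrow> y \<in> carrier A \<Longrightarrow> P (x \<otimes>\<^bsub>A\<^esub> y)"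
    and "\<And>x y. x \<in> carrier A \<Longrightarrow> y \<in> carrier A \<Longrightarrow> P x \<Longrightarrow> P y \<Longrightarrow> P (x \<oplus>\<^bsub>A\<^esub> y)"
  shows "P x"
  by (rule assms(1)[unfolded product_generated_def, rule_format, where P = P])
    (simp_all add: assms(2-4))

text \<open>Scalars are absorbed into products, \<open>r (a b) = (r a) b\<close>, so a linear
  combination of products is already a sum of products.\<close>

lemma (in nonassoc_algebra) product_generated_if_perfect:
  assumes "perfect_algebra R A"
  shows "product_generated A"
proof (rule product_generatedI)
  fix P x
  assume mult: "\<And>x y. x \<in> carrier A \<Longrightarrow> y \<in> carrier A \<Longrightarrow> P (x \<otimes>\<^bsub>A\<^esub> y)"
    and add: "\<And>x y. x \<in> carrier A \<Longrightarrow> y \<in> carrier A \<Longrightarrow> P x \<Longrightarrow> P y \<Longrightarrow> P (x \<oplus>\<^bsub>A\<^esub> y)"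
    and x: "x \<in> carrier A"
  \<comment> \<open>The empty linear combination must satisfy \<open>P\<close> too; zero qualifies
    because it is the product of zero with itself.\<close>
  have zero: "P \<zero>\<^bsub>A\<^esub>"
  proof -
    have "\<zero>\<^bsub>A\<^esub> \<otimes>\<^bsub>A\<^esub> \<zero>\<^bsub>A\<^esub> = (\<zero> \<odot>\<^bsub>A\<^esub> \<zero>\<^bsub>A\<^esub>) \<otimes>\<^bsub>A\<^esub> \<zero>\<^bsub>A\<^esub>" by simp
    also have "\<dots> = \<zero>\<^bsub>A\<^esub>" by (subst prod_smult_left) (simp_all add: prod_closed)
    finally show ?thesis using mult[of "\<zero>\<^bsub>A\<^esub>" "\<zero>\<^bsub>A\<^esub>"] by simp
  qed
  let ?G = "{a \<otimes>\<^bsub>A\<^esub> b | a b. a \<in> carrier A \<and> b \<in> carrier A}"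
  have "P (\<Oplus>\<^bsub>A\<^esub>x\<in>S. f x \<odot>\<^bsub>A\<^esub> x)" if "finite S" "S \<subseteq> ?G" "f \<in> S \<rightarrow> carrier R" for S f
    using that
  proof (induction S rule: finite_induct)
    case empty
    then show ?case using zero by simp
  next
    case (insert y S)
    obtain a b where y: "y = a \<otimes>\<^bsub>A\<^esub> b" "a \<in> carrier A" "b \<in> carrier A" using insert.prems by auto
    have "P (f y \<odot>\<^bsub>A\<^esub> y)"
      using mult[of "f y \<odot>\<^bsub>A\<^esub> a" b] insert.prems y by (simp add: prod_smult_left)
    moreover have "S \<subseteq> carrier A" using insert.prems by (auto simp: prod_closed)
    then have c: "(\<lambda>x. f x \<odot>\<^bsub>A\<^esub> x) \<in> S \<rightarrow> carrier A" using insert.prems by auto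
    moreover have "f y \<odot>\<^bsub>A\<^esub> y \<in> carrier A" using y insert.prems by (simp add: prod_closed)
    ultimately show ?case
      using insert by (subst M.finsum_insert) (auto intro!: add M.finsum_closed)
  qed
  moreover have "x \<in> lin_span R A ?G" using x assms unfolding perfect_algebra_def by (simp only:)
  then obtain S f where "x = (\<Oplus>\<^bsub>A\<^esub>x\<in>S. f x \<odot>\<^bsub>A\<^esub> x)" "finite S" "S \<subseteq> ?G" "f \<in> S \<rightarrow> carrier R"
    unfolding lin_span_def mem_Collect_eq by (elim exE conjE)
  ultimately show "P x" by (simp only:)
qed

lemma product_generated_image:
  assumes A: "product_generated A"
    and g: "g ` carrier A = carrier A'"
      "\<And>x y. x \<in> carrier A \<Longrightarrow> y \<in> carrier A \<Longrightarrow> g (x \<oplus>\<^bsub>A\<^esub> y) = g x \<oplus>\<^bsub>A'\<^esub> g y"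
      "\<And>x y. x \<in> carrier A \<Longrightarrow> y \<in> carrier A \<Longrightarrow> g (x \<otimes>\<^bsub>A\<^esub> y) = g x \<otimes>\<^bsub>A'\<^esub> g y"
  shows "product_generated A'"
proof (rule product_generatedI)
  fix P x'
  assume P_mult: "\<And>x y. x \<in> carrier A' \<Longrightarrow> y \<in> carrier A' \<Longrightarrow> P (x \<otimes>\<^bsub>A'\<^esub> y)"
    and P_add: "\<And>x y. x \<in> carrier A' \<Longrightarrow> y \<in> carrier A' \<Longrightarrow> P x \<Longrightarrow> P y \<Longrightarrow> P (x \<oplus>\<^bsub>A'\<^esub> y)"
    and x': "x' \<in> carrier A'"
  obtain x where x: "x' = g x" "x \<in> carrier A" using x' unfolding g(1)[symmetric] by (rule imageE)
  have gc: "g y \<in> carrier A'" if "y \<in> carrier A" for y using that g(1) by auto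
  have "P (g x)"
    using A x(2)
  proof (induction x rule: product_generated_induct)
    case (mult y z)
    then show ?case using P_mult[OF gc gc, of y z] g(3) by simp
  next
    case (add y z)
    then show ?case using P_add[OF gc gc, of y z] g(2) by simp
  qed
  then show "P x'" using x by simp
qed

section \<open>Perfectness: ascent to a base change and descent from it\<close>

context algebra_base_change
begin

text \<open>The unit of \<open>B\<close> lets a product in the first factor absorb the second:
  \<open>(x y) \<otimes> b = (x \<otimes> 1) (y \<otimes> b)\<close>.\<close>

lemma product_generated_base_change:
  assumes A: "product_generated A"
  shows "product_generated AB"
proof (rule product_generatedI)
  fix P t
  assume P_mult: "\<And>x y. x \<in> carrier AB \<Longrightarrow> y \<in> carrier AB \<Longrightarrow> P (x \<otimes>\<^bsub>AB\<^esub> y)"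
    and P_add: "\<And>x y. x \<in> carrier AB \<Longrightarrow> y \<in> carrier AB \<Longrightarrow> P x \<Longrightarrow> P y \<Longrightarrow> P (x \<oplus>\<^bsub>AB\<^esub> y)"
    and "t \<in> carrier AB"
  from this(3) show "P t"
  proof (induction t rule: AB_induct)
    case (pure a b)
    from A pure(1) show ?case
    proof (induction a rule: product_generated_induct)
      case (mult x y)
      then show ?case
        using P_mult[of "x \<otimes>\<otimes> \<one>\<^bsub>B\<^esub>" "y \<otimes>\<otimes> b"] pure(2) by (simp add: AB_pure_closed AB_mult_pure)
    next
      case (add x y)
      then show ?case
        using P_add[of "x \<otimes>\<otimes> b" "y \<otimes>\<otimes> b"] pure(2) by (simp add: AB_pure_closed AB_add_left)
    qed
  next
    case (add t u)
    then show ?case by (intro P_add)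
  qed
qed

text \<open>The retraction \<open>\<pi>\<close> need not be multiplicative, since \<open>p\<close>
  need not be. It nevertheless sends \<open>(a \<otimes> b) (c \<otimes> d)\<close> to
  \<open>(p (b d) a) c\<close>, which is a product in \<open>A\<close>; hence images of products are
  sums of products, and every \<open>x\<close> is the image of \<open>x \<otimes> 1\<close>.\<close>

lemma product_generated_descent:
  assumes p: "\<And>b. b \<in> carrier B \<Longrightarrow> p b \<in> carrier R"
      "\<And>b c. b \<in> carrier B \<Longrightarrow> c \<in> carrier B \<Longrightarrow> p (b \<oplus>\<^bsub>B\<^esub> c) = p b \<oplus>\<^bsub>R\<^esub> p c"
      "\<And>r b. r \<in> carrier R \<Longrightarrow> b \<in> carrier B \<Longrightarrow> p (r \<odot>\<^bsub>B\<^esub> b) = r \<otimes>\<^bsub>R\<^esub> p b"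
      "p \<one>\<^bsub>B\<^esub> = \<one>\<^bsub>R\<^esub>"
    and AB: "product_generated AB"
  shows "product_generated A"
proof (rule product_generatedI)
  obtain \<pi> where pi: "\<And>t. t \<in> carrier AB \<Longrightarrow> \<pi> t \<in> carrier A"
      "\<And>t u. t \<in> carrier AB \<Longrightarrow> u \<in> carrier AB \<Longrightarrow> \<pi> (t \<oplus>\<^bsub>AB\<^esub> u) = \<pi> t \<oplus>\<^bsub>A\<^esub> \<pi> u"
      "\<And>a b. a \<in> carrier A \<Longrightarrow> b \<in> carrier B \<Longrightarrow> \<pi> (a \<otimes>\<otimes> b) = p b \<odot>\<^bsub>A\<^esub> a"
    by (rule AB_lift[where f = "\<lambda>a b. p b \<odot>\<^bsub>A\<^esub> a" and G = A, OF A.M.abelian_group_axioms])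
      (simp_all add: p A.smult_l_distr A.smult_r_distr A.smult_assoc1[symmetric] A.R.m_comm, blast)
  fix P x
  assume P_mult: "\<And>x y. x \<in> carrier A \<Longrightarrow> y \<in> carrier A \<Longrightarrow> P (x \<otimes>\<^bsub>A\<^esub> y)"
    and P_add: "\<And>x y. x \<in> carrier A \<Longrightarrow> y \<in> carrier A \<Longrightarrow> P x \<Longrightarrow> P y \<Longrightarrow> P (x \<oplus>\<^bsub>A\<^esub> y)"
    and x: "x \<in> carrier A"
  have P_pi_mult: "P (\<pi> (t \<otimes>\<^bsub>AB\<^esub> u))" if t: "t \<in> carrier AB" and u: "u \<in> carrier AB" for t u
    using t
  proof (induction t rule: AB_induct)
    case (pure a b)
    note ab = pure
    show ?case using u
    proof (induction u rule: AB_induct)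
      case (pure c d)
      then show ?case using P_mult[of "p (b \<otimes>\<^bsub>B\<^esub> d) \<odot>\<^bsub>A\<^esub> a" c] ab
        by (simp add: AB_mult_pure pi p A.prod_closed A.prod_smult_left)
    next
      case (add v w)
      then show ?case using ab by (simp add: AB_mult AB_pure_closed pi P_add)
    qed
  next
    case (add v w)
    then show ?case using u by (simp add: AB_mult pi P_add)
  qed
  have "P (\<pi> t)" if "t \<in> carrier AB" for t
    using AB that
  proof (induction t rule: product_generated_induct)
    case (mult t u)
    then show ?case by (rule P_pi_mult)
  next
    case (add t u)
    then show ?case by (simp add: pi P_add)
  qed
  from this[of "x \<otimes>\<otimes> \<one>\<^bsub>B\<^esub>"] show "P x" using x by (simp add: AB_pure_closed pi p)
qed

end

section \<open>Restriction to subalgebras\<close>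

lemma nonassoc_algebra_restrict_scalars:
  assumes A: "nonassoc_algebra B A" and C: "subring C B"
  shows "nonassoc_algebra (B\<lparr>carrier := C\<rparr>) A"
proof -
  interpret A: nonassoc_algebra B A by fact
  have CB: "C \<subseteq> carrier B" by (rule subringE(1)[OF C])
  have "cring (B\<lparr>carrier := C\<rparr>)"
    using A.R.subcringI'[OF C] A.R.subcring_iff[OF CB] by blast
  then show ?thesis
    using CB
    by (intro nonassoc_algebra.intro nonassoc_algebra_axioms.intro moduleI A.M.abelian_group_axioms)
      (auto simp: A.smult_l_distr A.smult_r_distr A.smult_assoc1 A.prod_closed A.prod_add_left
        A.prod_add_right A.prod_smult_left A.prod_smult_right subset_iff)
qed

lemma nonassoc_algebra_subalgebra:
  assumes A: "nonassoc_algebra R A" and L: "nonunital_subalgebra L R A"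
  shows "nonassoc_algebra R (A\<lparr>carrier := L\<rparr>)"
proof -
  interpret A: nonassoc_algebra R A by fact
  have sub: "submodule L R A" and mult: "\<And>x y. x \<in> L \<Longrightarrow> y \<in> L \<Longrightarrow> x \<otimes>\<^bsub>A\<^esub> y \<in> L"
    using L by (auto simp: nonunital_subalgebra_def)
  have LA: "L \<subseteq> carrier A" by (rule A.submoduleE(1)[OF sub])
  have "module R (A\<lparr>carrier := L\<rparr>)"
    by (rule submodule.submodule_is_module[OF sub A.module_axioms])
  then show ?thesis
    using LA
    by (intro nonassoc_algebra.intro nonassoc_algebra_axioms.intro)
      (auto simp: mult A.prod_add_left A.prod_add_right A.prod_smult_left A.prod_smult_right subset_iff)
qed

lemma self_module_simps:
  "carrier (self_module B) = carrier B" "monoid.mult (self_module B) = monoid.mult B"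
  "one (self_module B) = one B" "ring.zero (self_module B) = ring.zero B"
  "ring.add (self_module B) = ring.add B" "smult (self_module B) = monoid.mult B"
  by (simp_all add: self_module_def with_smult_def)

lemma self_module_algebra:
  assumes B: "cring B" and C: "subring C B"
  shows "algebra (B\<lparr>carrier := C\<rparr>) (self_module B)"
proof -
  interpret cring B by fact
  have CB: "C \<subseteq> carrier B" by (rule subringE(1)[OF C])
  have "cring (B\<lparr>carrier := C\<rparr>)"
    using subcringI'[OF C] subcring_iff[OF CB] by blast
  moreover have "cring (self_module B)"
    by (rule cringI; (rule abelian_groupI comm_monoidI)?)
      (auto simp: self_module_simps a_ac m_ac l_distr r_distr intro: l_neg)
  ultimately show ?thesis
    using CB by (intro algebraI) (auto simp: self_module_simps l_distr r_distr m_assoc subset_iff)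
qed

section \<open>The centroid of a form\<close>

text \<open>The base change of L has \<open>self_module B\<close> as its ring of scalars, whereas
  the isomorphism in \<open>is_form\<close> is one of algebras over \<open>B\<close> itself. The two
  records have the same ring structure, so this lemma and the next one pass between them.\<close>

lemma nonassoc_algebra_self_moduleD:
  assumes A: "nonassoc_algebra (self_module B) A" and B: "cring B"
  shows "nonassoc_algebra B A"
proof -
  interpret A: nonassoc_algebra "self_module B" A by fact
  note [simp] = self_module_simps
  show ?thesis
    using A.smult_closed A.smult_l_distr A.smult_r_distr A.smult_assoc1 A.smult_one
    by (intro nonassoc_algebra.intro nonassoc_algebra_axioms.intro moduleI A.M.abelian_group_axioms B)
      (simp_all add: A.prod_closed A.prod_add_left A.prod_add_right A.prod_smult_left A.prod_smult_right)
qed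

lemma central_algebra_self_module: "central_algebra (self_module B) A = central_algebra B A"
  by (simp add: central_algebra_def Cent_def module_End_def scalar_maps_def self_module_simps)

text \<open>The same set L appears in two records: on the left with F acting on the first tensor
  factor, on the right with C acting through the second.\<close>

theorem corollary2p26:
  fixes F :: "('f, 'k) ring_scheme"
    and A :: "('f, 'a, 'm) module_scheme"
    and B :: "('f, 'b, 'n) module_scheme"
    and C :: "'b set"
    and L :: "('a \<times> 'b \<Rightarrow>\<^sub>0 int) set set"
  assumes "field F"
    and "nonassoc_algebra F A" and "central_algebra F A" and "perfect_algebra F A"
    and "algebra F B"
    and "unital_subalgebra C F B"
    and "\<exists>X. module_basis (B\<lparr>carrier := C\<rparr>) (self_module B) X \<and> \<one>\<^bsub>B\<^esub> \<in> X"
    and "is_form F A B C L"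
  shows "Cent F ((tensor_algebra F A B)\<lparr>carrier := L\<rparr>)
       = scalar_maps (B\<lparr>carrier := C\<rparr>) ((base_change F A B)\<lparr>carrier := L\<rparr>)"
proof -
  interpret AB: algebra_base_change F A B using assms(2,5) by (rule algebra_base_change.intro)
  let ?C = "B\<lparr>carrier := C\<rparr>" and ?AB = "base_change F A B" and ?S = "self_module B"
  let ?L = "?AB\<lparr>carrier := L\<rparr>"
  let ?LB = "base_change ?C ?L ?S"
  have C: "subring C B" "submodule C F B" using assms(6) by (auto simp: unital_subalgebra_def)
  have CB: "C \<subseteq> carrier B" by (rule subringE(1)[OF C(1)])
  have L: "nonunital_subalgebra L ?C ?AB" and iso: "alg_iso B ?LB ?AB \<noteq> {}"
    using assms(8) by (auto simp: is_form_def)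
  have "nonassoc_algebra ?C ?L"
    by (intro nonassoc_algebra_subalgebra nonassoc_algebra_restrict_scalars L C AB.AB.nonassoc_algebra_axioms)
  then interpret LB: algebra_base_change ?C ?L ?S
    using self_module_algebra[OF AB.B.M_cring C(1)] by (rule algebra_base_change.intro)
  have LB: "nonassoc_algebra B ?LB"
    by (rule nonassoc_algebra_self_moduleD[OF LB.AB.nonassoc_algebra_axioms AB.B.M_cring])
  obtain \<phi> where phi: "\<phi> \<in> alg_iso B ?LB ?AB" using iso by blast
  obtain X where X: "module_basis ?C ?S X" "\<one>\<^bsub>B\<^esub> \<in> X" using assms(7) by blast
  obtain k where k: "\<And>m x. m \<in> carrier ?S \<Longrightarrow> x \<in> X \<Longrightarrow> k m x \<in> carrier ?C"
      "\<And>m n x. m \<in> carrier ?S \<Longrightarrow> n \<in> carrier ?S \<Longrightarrow> x \<in> X \<Longrightarrow> k (m \<oplus>\<^bsub>?S\<^esub> n) x = k m x \<oplus>\<^bsub>?C\<^esub> k n x"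
      "\<And>r m x. r \<in> carrier ?C \<Longrightarrow> m \<in> carrier ?S \<Longrightarrow> x \<in> X \<Longrightarrow> k (r \<odot>\<^bsub>?S\<^esub> m) x = r \<otimes>\<^bsub>?C\<^esub> k m x"
      "\<And>x. x \<in> X \<Longrightarrow> k x x = \<one>\<^bsub>?C\<^esub>"
    by (rule LB.B.basis_coordinates[OF X(1)]) (rule that)
  \<comment> \<open>The coordinate at the basis element 1; \<open>k x x = 1\<close> at this element
    gives \<open>p 1 = 1\<close>.\<close>
  define p where "p b = k b \<one>\<^bsub>B\<^esub>" for b
  have p: "\<And>b. b \<in> carrier ?S \<Longrightarrow> p b \<in> carrier ?C"
      "\<And>b c. b \<in> carrier ?S \<Longrightarrow> c \<in> carrier ?S \<Longrightarrow> p (b \<oplus>\<^bsub>?S\<^esub> c) = p b \<oplus>\<^bsub>?C\<^esub> p c"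
      "\<And>r b. r \<in> carrier ?C \<Longrightarrow> b \<in> carrier ?S \<Longrightarrow> p (r \<odot>\<^bsub>?S\<^esub> b) = r \<otimes>\<^bsub>?C\<^esub> p b"
      "p \<one>\<^bsub>?S\<^esub> = \<one>\<^bsub>?C\<^esub>"
    unfolding p_def using k X(2) by (simp_all add: self_module_simps(3))
  have "central_algebra B ?AB" by (rule AB.central_base_change[OF assms(1,3)])
  then have "central_algebra B ?LB"
    by (rule central_algebra_alg_iso[OF LB AB.AB.nonassoc_algebra_axioms phi])
  then have central: "central_algebra ?C ?L"
    by (intro LB.central_descent[OF p]) (simp_all add: central_algebra_self_module)
  \<comment> \<open>Centrality was pulled back along \<open>\<phi>\<close>, but generation by
    products is pushed forward along a surjection, so here the inverse isomorphism is the one to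
    use.\<close>
  note psi = alg_isoD[OF alg_iso_inverse[OF LB phi]]
  have "product_generated ?AB"
    by (intro AB.product_generated_base_change AB.A.product_generated_if_perfect assms(4))
  then have "product_generated ?LB"
    by (rule product_generated_image[OF _ bij_betw_imp_surj_on[OF psi(1)] psi(2,3)])
  then have generated: "product_generated ?L"
    by (intro LB.product_generated_descent[OF p]) simp_all
  \<comment> \<open>\<open>?T\<close> and \<open>?L\<close> share carrier, sum and product, so their
    centroids can differ only through linearity over F or over C.\<close>
  let ?T = "(tensor_algebra F A B)\<lparr>carrier := L\<rparr>"
  have T: "carrier ?T = carrier ?L" "monoid.mult ?T = monoid.mult ?L" "ring.add ?T = ring.add ?L"
    by (simp_all add: base_change_simps)
  have LA: "carrier ?L \<subseteq> carrier ?AB"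
    using L submodule.axioms(1) subgroup.subset by (fastforce simp: nonunital_subalgebra_def)
  have "Cent F ?T = Cent ?C ?L"
  proof (intro subset_antisym subsetI)
    fix \<chi> assume "\<chi> \<in> Cent F ?T"
    note c = CentD[OF this, unfolded T]
    show "\<chi> \<in> Cent ?C ?L"
    proof (rule CentI)
      show "\<chi> \<in> carrier ?L \<rightarrow>\<^sub>E carrier ?L" using c(1,2) by (auto simp: PiE_iff)
    next
      fix r x assume r: "r \<in> carrier ?C" and "x \<in> carrier ?L"
      \<comment> \<open>C-linearity is tested on products, where the scalar rides on the left factor
        while \<open>\<chi>\<close> acts on the right one, and then extended along sums.\<close>
      from generated this(2) show "\<chi> (r \<odot>\<^bsub>?L\<^esub> x) = r \<odot>\<^bsub>?L\<^esub> \<chi> x"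
      proof (induction x rule: product_generated_induct)
        case (mult x y)
        have "\<chi> (r \<odot>\<^bsub>?L\<^esub> (x \<otimes>\<^bsub>?L\<^esub> y)) = \<chi> ((r \<odot>\<^bsub>?L\<^esub> x) \<otimes>\<^bsub>?L\<^esub> y)"
          by (simp only: LB.A.prod_smult_left[OF r mult])
        also have "\<dots> = (r \<odot>\<^bsub>?L\<^esub> x) \<otimes>\<^bsub>?L\<^esub> \<chi> y"
          by (rule c(5)[OF LB.A.smult_closed[OF r mult(1)] mult(2)])
        also have "\<dots> = r \<odot>\<^bsub>?L\<^esub> (x \<otimes>\<^bsub>?L\<^esub> \<chi> y)"
          by (rule LB.A.prod_smult_left[OF r mult(1) c(2)[OF mult(2)]])
        also have "\<dots> = r \<odot>\<^bsub>?L\<^esub> \<chi> (x \<otimes>\<^bsub>?L\<^esub> y)" by (simp only: c(5)[OF mult])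
        finally show ?case .
      next
        case (add x y)
        show ?case
          unfolding LB.A.smult_r_distr[OF r add(1,2)] c(3)[OF add(1,2)]
            c(3)[OF LB.A.smult_closed[OF r add(1)] LB.A.smult_closed[OF r add(2)]]
            LB.A.smult_r_distr[OF r c(2)[OF add(1)] c(2)[OF add(2)]] add.IH ..
      qed
    next
      show "\<chi> (x \<oplus>\<^bsub>?L\<^esub> y) = \<chi> x \<oplus>\<^bsub>?L\<^esub> \<chi> y" if "x \<in> carrier ?L" "y \<in> carrier ?L" for x y
        using that by (rule c(3))
      show "\<chi> (x \<otimes>\<^bsub>?L\<^esub> y) = x \<otimes>\<^bsub>?L\<^esub> \<chi> y" if "x \<in> carrier ?L" "y \<in> carrier ?L" for x y
        using that by (rule c(5))
      show "\<chi> (x \<otimes>\<^bsub>?L\<^esub> y) = \<chi> x \<otimes>\<^bsub>?L\<^esub> y" if "x \<in> carrier ?L" "y \<in> carrier ?L" for x y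
        using that by (rule c(6))
    qed
  next
    fix \<chi> assume "\<chi> \<in> Cent ?C ?L"
    note c = CentD[OF this]
    show "\<chi> \<in> Cent F ?T"
    proof (rule CentI; unfold T)
      show "\<chi> \<in> carrier ?L \<rightarrow>\<^sub>E carrier ?L" using c(1,2) by (auto simp: PiE_iff)
    next
      \<comment> \<open>C contains 1 and is an F-submodule of \<open>B\<close>, so
        \<open>r 1\<close> lies in C, and F-linearity is a special case of C-linearity.\<close>
      fix r x assume r: "r \<in> carrier F" and x: "x \<in> carrier ?L"
      have "\<one>\<^bsub>B\<^esub> \<in> C" by (rule subringE(3)[OF C(1)])
      then have r1: "r \<odot>\<^bsub>B\<^esub> \<one>\<^bsub>B\<^esub> \<in> carrier ?C" using submodule.smult_closed[OF C(2) r] by simp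
      have eq: "r \<odot>\<^bsub>?T\<^esub> y = (r \<odot>\<^bsub>B\<^esub> \<one>\<^bsub>B\<^esub>) \<odot>\<^bsub>?L\<^esub> y" if "y \<in> carrier ?L" for y
        using AB.tensor_smult_eq[OF r subsetD[OF LA that]] by simp
      show "\<chi> (r \<odot>\<^bsub>?T\<^esub> x) = r \<odot>\<^bsub>?T\<^esub> \<chi> x"
        unfolding eq[OF x] eq[OF c(2)[OF x]] by (rule c(4)[OF r1 x])
    next
      show "\<chi> (x \<oplus>\<^bsub>?L\<^esub> y) = \<chi> x \<oplus>\<^bsub>?L\<^esub> \<chi> y" if "x \<in> carrier ?L" "y \<in> carrier ?L" for x y
        using that by (rule c(3))
      show "\<chi> (x \<otimes>\<^bsub>?L\<^esub> y) = x \<otimes>\<^bsub>?L\<^esub> \<chi> y" if "x \<in> carrier ?L" "y \<in> carrier ?L" for x y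
        using that by (rule c(5))
      show "\<chi> (x \<otimes>\<^bsub>?L\<^esub> y) = \<chi> x \<otimes>\<^bsub>?L\<^esub> y" if "x \<in> carrier ?L" "y \<in> carrier ?L" for x y
        using that by (rule c(6))
    qed
  qed
  also have "\<dots> = scalar_maps ?C ?L" using central by (simp only: central_algebra_def)
  finally show ?thesis .
qed

end
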